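(* For every $\epsilon>0$ (and every $k$), there is a two-sided, adaptive distribution-free testing algorithm for $\epsilon$-testing $k$-juntas that makes $\tilde O(k/\epsilon)$ queries to $f$.
   Context: A function $f:\{0,1\}^n\to\{0,1\}$ is a $k$-junta if it depends on at most $k$ of its variables. For a probability distribution $\mathcal D$ on $\{0,1\}^n$, $f$ is $\epsilon$-far from $g$ with respect to $\mathcal D$ if $\Pr_{x\sim\mathcal D}[f(x)\neq g(x)]\ge\epsilon$, and $f$ is $\epsilon$-far from every $k$-junta with respect to $\mathcal D$ if this holds for every $k$-junta $g$. In the distribution-free testing model, the algorithm receives $\epsilon$ (and $k$) and has access to two oracles: a black box that returns $f(x)$ for any queried $x\in\{0,1\}^n$, and a sampling oracle that returns independent samples $x\in\{0,1\}^n$ drawn from an arbitrary, unknown distribution $\mathcal D$. The algorithm must (1) output "accept" with probability at least $2/3$ if $f$ is a $k$-junta, and (2) output "reject" with probability at least $2/3$ if $f$ is $\epsilon$-far from every $k$-junta with respect to $\mathcal D$. "Two-sided" means the algorithm may err in both cases (it is not required to always accept $k$-juntas); "adaptive" means queries may depend on answers to previous queries. The query complexity is the number of queries made to $f$ (samples from $\mathcal D$ are not counted as queries). $\tilde O(\cdot)$ hides factors polylogarithmic in $k/\epsilon$. *)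

theory Defs
  imports "HOL-Probability.Probability"
begin

definition cube :: "nat \<Rightarrow> bool list set" where
  "cube n = {x. length x = n}"

definition is_junta :: "nat \<Rightarrow> nat \<Rightarrow> (bool list \<Rightarrow> bool) \<Rightarrow> bool" where
  "is_junta n k f \<longleftrightarrow> (\<exists>J. J \<subseteq> {..<n} \<and> card J \<le> k \<and>
      (\<forall>x\<in>cube n. \<forall>y\<in>cube n. (\<forall>i\<in>J. x ! i = y ! i) \<longrightarrow> f x = f y))"

definition far_from_juntas ::
  "nat \<Rightarrow> nat \<Rightarrow> real \<Rightarrow> bool list pmf \<Rightarrow> (bool list \<Rightarrow> bool) \<Rightarrow> bool" where
  "far_from_juntas n k eps D f \<longleftrightarrow>
     (\<forall>g. is_junta n k g \<longrightarrow> measure_pmf.prob D {x. f x \<noteq> g x} \<ge> eps)"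

text \<open>Randomized adaptive oracle algorithms, as (well-founded) decision trees:
  query the black box for f, draw a sample from D, flip a fair coin, or halt.\<close>
datatype alg =
    Accept
  | Reject
  | Query "bool list" "bool \<Rightarrow> alg"
  | Sample "bool list \<Rightarrow> alg"
  | Coin "bool \<Rightarrow> alg"

primrec run :: "alg \<Rightarrow> (bool list \<Rightarrow> bool) \<Rightarrow> bool list pmf \<Rightarrow> bool pmf" where
  "run Accept f D = return_pmf True"
| "run Reject f D = return_pmf False"
| "run (Query x c) f D = run (c (f x)) f D"
| "run (Sample c) f D = bind_pmf D (\<lambda>x. run (c x) f D)"
| "run (Coin c) f D = bind_pmf (bernoulli_pmf (1/2)) (\<lambda>b. run (c b) f D)"

primrec queries_le :: "alg \<Rightarrow> nat \<Rightarrow> bool" where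
  "queries_le Accept m = True"
| "queries_le Reject m = True"
| "queries_le (Query x c) m = (0 < m \<and> (\<forall>b. queries_le (c b) (m - 1)))"
| "queries_le (Sample c) m = (\<forall>x. queries_le (c x) m)"
| "queries_le (Coin c) m = (\<forall>b. queries_le (c b) m)"

definition df_junta_tester :: "nat \<Rightarrow> nat \<Rightarrow> real \<Rightarrow> alg \<Rightarrow> bool" where
  "df_junta_tester n k eps A \<longleftrightarrow>
     (\<forall>f D. set_pmf D \<subseteq> cube n \<longrightarrow>
        (is_junta n k f \<longrightarrow> pmf (run A f D) True \<ge> 2/3) \<and>
        (far_from_juntas n k eps D f \<longrightarrow> pmf (run A f D) False \<ge> 2/3))"

end

theory Submission
  imports Defs
begin

text \<open>
  Hash the coordinates at random into about \<open>k\<^sup>2\<close> blocks, so that the relevant variables of a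
  \<open>k\<close>-junta most likely fall into distinct blocks. Maintain a list of relevant blocks, and compare
  \<open>f u\<close> for samples \<open>u\<close> with the value after zeroing \<open>u\<close> outside these blocks. A mismatch yields, by
  bisection over the blocks, a new relevant block and a witness; the function obtained by varying
  only this block must then be a literal, which is tested with \<open>O(log k)\<close> queries. When all samples
  of a round match, every sample is decoded: for each block the value \<open>u\<^sub>i\<close> of its literal is read off
  as \<open>h (u + z) + h z\<close> for random \<open>z\<close>, unanimously over \<open>O(log k)\<close> choices of \<open>z\<close>, and \<open>f u\<close> is compared
  with the value of \<open>f\<close> at the point that is constant on each block with these values. This last
  comparison is against a \<open>k\<close>-junta, so it fails for functions far from juntas, while for a junta
  with separated relevant variables no step ever rejects. Only the last round decodes, so the number
  of queries is \<open>k\<close> times \<open>1/\<epsilon>\<close> up to logarithms.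
\<close>

section \<open>Discrete probability\<close>

lemma prob_eq_pmf_map: "measure_pmf.prob M {x. P x} = pmf (map_pmf P M) True"
  by (simp add: pmf_map vimage_def)

lemma prob_bind_pmf:
  "measure_pmf.prob (bind_pmf N f) {x. P x} = (\<integral>x. measure_pmf.prob (f x) {y. P y} \<partial>measure_pmf N)"
  by (simp only: prob_eq_pmf_map map_bind_pmf pmf_bind)

lemma prob_pair_pmf:
  "measure_pmf.prob (pair_pmf A B) {z. P z} = (\<integral>a. measure_pmf.prob B {b. P (a, b)} \<partial>measure_pmf A)"
proof -
  have "measure_pmf.prob (pair_pmf A B) {z. P z} =
      measure_pmf.prob (bind_pmf A (\<lambda>a. map_pmf (Pair a) B)) {z. P z}"
    by (simp add: pair_pmf_def map_pmf_def)
  then show ?thesis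
    by (simp add: prob_bind_pmf vimage_def)
qed

lemma prob_mono_on:
  assumes "\<And>x. x \<in> set_pmf M \<Longrightarrow> P x \<Longrightarrow> Q x"
  shows "measure_pmf.prob M {x. P x} \<le> measure_pmf.prob M {x. Q x}"
proof -
  have "measure_pmf.prob M {x. P x} = measure_pmf.prob M ({x. P x} \<inter> set_pmf M)"
    by (simp add: measure_Int_set_pmf)
  also have "\<dots> \<le> measure_pmf.prob M {x. Q x}"
    using assms by (intro measure_pmf.finite_measure_mono) auto
  finally show ?thesis .
qed

lemma prob_disj_le:
  "measure_pmf.prob M {x. P x \<or> Q x} \<le> measure_pmf.prob M {x. P x} + measure_pmf.prob M {x. Q x}"
  using measure_Un_le[of "{x. P x}" "measure_pmf M" "{x. Q x}"]
  by (simp add: Un_def)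

lemma prob_not: "measure_pmf.prob M {x. \<not> P x} = 1 - measure_pmf.prob M {x. P x}"
  using measure_pmf.prob_compl[of "{x. P x}" M] by (simp add: Compl_eq_Diff_UNIV[symmetric] Compl_eq)

lemma prob_lt_1_obtains:
  assumes "measure_pmf.prob M {x. P x} < 1"
  obtains x where "x \<in> set_pmf M" "\<not> P x"
proof -
  have "\<exists>x\<in>set_pmf M. \<not> P x"
  proof (rule ccontr)
    assume "\<not> ?thesis"
    then have "measure_pmf.prob M {x. True} \<le> measure_pmf.prob M {x. P x}"
      by (intro prob_mono_on) auto
    with assms show False by simp
  qed
  with that show thesis by blast
qed

lemma prob_Bex_list_le:
  assumes "\<And>e. e \<in> set L \<Longrightarrow> measure_pmf.prob M {x. P e x} \<le> b"
  shows "measure_pmf.prob M {x. \<exists>e\<in>set L. P e x} \<le> real (length L) * b"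
  using assms
proof (induction L)
  case (Cons a L)
  have "measure_pmf.prob M {x. \<exists>e\<in>set (a # L). P e x} \<le>
      measure_pmf.prob M {x. P a x} + measure_pmf.prob M {x. \<exists>e\<in>set L. P e x}"
    using prob_disj_le[of M "P a" "\<lambda>x. \<exists>e\<in>set L. P e x"] by simp
  also have "\<dots> \<le> b + real (length L) * b"
    using Cons by (intro add_mono) auto
  finally show ?case by (simp add: algebra_simps)
qed simp

lemma integrable_pmf_bounded:
  fixes g :: "'a \<Rightarrow> real"
  assumes "\<And>x. \<bar>g x\<bar> \<le> c"
  shows "integrable (measure_pmf M) g"
  by (rule measure_pmf.integrable_const_bound[of _ c]) (use assms in auto)

lemma integral_pmf_le:
  fixes g :: "'a \<Rightarrow> real"
  assumes "\<And>x. 0 \<le> g x" "\<And>x. g x \<le> 1" "0 \<le> b"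
    and "\<And>x. x \<in> set_pmf M \<Longrightarrow> \<not> P x \<Longrightarrow> g x \<le> b"
  shows "(\<integral>x. g x \<partial>measure_pmf M) \<le> measure_pmf.prob M {x. P x} + b"
proof -
  have "(\<integral>x. g x \<partial>measure_pmf M) \<le> (\<integral>x. indicator {x. P x} x + b \<partial>measure_pmf M)"
  proof (rule integral_mono_AE)
    show "integrable (measure_pmf M) g"
      using assms(1,2) by (intro integrable_pmf_bounded[of _ 1]) auto
    show "integrable (measure_pmf M) (\<lambda>x. indicator {x. P x} x + b)"
      using assms(3) by (intro integrable_pmf_bounded[of _ "1 + b"]) (auto simp: indicator_def)
    show "AE x in measure_pmf M. g x \<le> indicator {x. P x} x + b"
      using assms by (auto simp: AE_measure_pmf_iff indicator_def intro: add_increasing2)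
  qed
  also have "\<dots> = measure_pmf.prob M {x. P x} + b"
    by (subst Bochner_Integration.integral_add) (auto intro: integrable_pmf_bounded[of _ 1])
  finally show ?thesis .
qed

lemma integral_pmf_ge:
  fixes g :: "'a \<Rightarrow> real"
  assumes "\<And>x. 0 \<le> g x" "\<And>x. g x \<le> 1" "0 \<le> b"
    and "\<And>x. x \<in> set_pmf M \<Longrightarrow> P x \<Longrightarrow> b \<le> g x"
  shows "b * measure_pmf.prob M {x. P x} \<le> (\<integral>x. g x \<partial>measure_pmf M)"
proof -
  have "b * measure_pmf.prob M {x. P x} = (\<integral>x. b * indicator {x. P x} x \<partial>measure_pmf M)"
    by simp
  also have "\<dots> \<le> (\<integral>x. g x \<partial>measure_pmf M)"
  proof (rule integral_mono_AE)
    show "integrable (measure_pmf M) g"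
      using assms(1,2) by (intro integrable_pmf_bounded[of _ 1]) auto
    show "integrable (measure_pmf M) (\<lambda>x. b * indicator {x. P x} x)"
      using assms(3) by (intro integrable_pmf_bounded[of _ b]) (auto simp: indicator_def)
    show "AE x in measure_pmf M. b * indicator {x. P x} x \<le> g x"
      using assms by (auto simp: AE_measure_pmf_iff indicator_def)
  qed
  finally show ?thesis .
qed

lemma prob_replicate_all:
  "measure_pmf.prob (replicate_pmf m p) {xs. \<forall>x\<in>set xs. P x} = measure_pmf.prob p {x. P x} ^ m"
proof (induction m)
  case (Suc m)
  have "measure_pmf.prob (replicate_pmf (Suc m) p) {xs. \<forall>x\<in>set xs. P x} =
    (\<integral>x. measure_pmf.prob (replicate_pmf m p) {xs. P x \<and> (\<forall>y\<in>set xs. P y)} \<partial>measure_pmf p)"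
    by (simp add: prob_bind_pmf map_pmf_def[symmetric] vimage_def)
  also have "\<dots> = (\<integral>x. indicator {x. P x} x * measure_pmf.prob p {x. P x} ^ m \<partial>measure_pmf p)"
    by (intro Bochner_Integration.integral_cong) (auto simp: indicator_def Suc)
  finally show ?case by simp
qed simp

section \<open>Boolean vectors\<close>

text \<open>With \<open>xorv\<close> as addition and \<open>andv\<close> as multiplication,
  \<open>cube n\<close> is the \<open>n\<close>-fold product of the two-element field.\<close>

definition xorv :: "bool list \<Rightarrow> bool list \<Rightarrow> bool list" where
  "xorv x y = map2 (\<noteq>) x y"

definition andv :: "bool list \<Rightarrow> bool list \<Rightarrow> bool list" where
  "andv x y = map2 (\<and>) x y"

definition bitvec :: "nat \<Rightarrow> (nat \<Rightarrow> bool) \<Rightarrow> bool list" where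
  "bitvec n P = map P [0..<n]"

abbreviation unif :: "nat \<Rightarrow> bool list pmf" where
  "unif n \<equiv> replicate_pmf n (bernoulli_pmf (1/2))"

lemma bitvec_in_cube [simp]: "bitvec n P \<in> cube n"
  by (simp add: bitvec_def cube_def)

lemma nth_bitvec [simp]: "i < n \<Longrightarrow> bitvec n P ! i = P i"
  by (simp add: bitvec_def)

lemma xorv_in_cube [simp]: "x \<in> cube n \<Longrightarrow> y \<in> cube n \<Longrightarrow> xorv x y \<in> cube n"
  by (simp add: xorv_def cube_def)

lemma andv_in_cube [simp]: "x \<in> cube n \<Longrightarrow> y \<in> cube n \<Longrightarrow> andv x y \<in> cube n"
  by (simp add: andv_def cube_def)

lemma length_bitvec [simp]: "length (bitvec n P) = n"
  by (simp add: bitvec_def)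

lemma length_xorv [simp]: "length (xorv x y) = min (length x) (length y)"
  by (simp add: xorv_def)

lemma length_andv [simp]: "length (andv x y) = min (length x) (length y)"
  by (simp add: andv_def)

lemma nth_xorv [simp]:
  "i < length x \<Longrightarrow> i < length y \<Longrightarrow> xorv x y ! i = (x ! i \<noteq> y ! i)"
  by (simp add: xorv_def)

lemma nth_andv [simp]:
  "i < length x \<Longrightarrow> i < length y \<Longrightarrow> andv x y ! i = (x ! i \<and> y ! i)"
  by (simp add: andv_def)

lemma cube_eqI: "x \<in> cube n \<Longrightarrow> y \<in> cube n \<Longrightarrow> (\<And>i. i < n \<Longrightarrow> x ! i = y ! i) \<Longrightarrow> x = y"
  by (auto simp: cube_def intro: nth_equalityI)

lemma xorv_assoc:
  "x \<in> cube n \<Longrightarrow> y \<in> cube n \<Longrightarrow> z \<in> cube n \<Longrightarrow> xorv (xorv x y) z = xorv x (xorv y z)"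
  by (rule cube_eqI[of _ n]) (auto simp: cube_def)

lemma andv_xorv_distrib:
  "x \<in> cube n \<Longrightarrow> y \<in> cube n \<Longrightarrow> z \<in> cube n \<Longrightarrow> andv (xorv x y) z = xorv (andv x z) (andv y z)"
  "x \<in> cube n \<Longrightarrow> y \<in> cube n \<Longrightarrow> z \<in> cube n \<Longrightarrow> andv z (xorv x y) = xorv (andv z x) (andv z y)"
  by (rule cube_eqI[of _ n]; auto simp: cube_def)+

section \<open>Translation invariance of the uniform distribution on the cube\<close>

lemma set_pmf_unif [simp]: "set_pmf (unif n) = cube n"
  by (auto simp: set_replicate_pmf cube_def set_pmf_bernoulli lists_eq_set)

lemma map_neq_bernoulli_half: "map_pmf (\<lambda>b. c \<noteq> b) (bernoulli_pmf (1/2)) = bernoulli_pmf (1/2)"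
proof (cases c)
  case True
  have "pmf (map_pmf Not (bernoulli_pmf (1/2))) i = pmf (bernoulli_pmf (1/2)) i" for i
    using pmf_map_inj'[of Not "bernoulli_pmf (1/2)" "\<not> i"] by (cases i) (simp_all add: inj_def)
  with True show ?thesis by (simp add: pmf_eq_iff)
qed simp

lemma map_xorv_unif: "v \<in> cube n \<Longrightarrow> map_pmf (xorv v) (unif n) = unif n"
proof (induction n arbitrary: v)
  case 0
  then show ?case by (simp add: cube_def xorv_def)
next
  case (Suc n)
  then obtain c w where v: "v = c # w" and w: "w \<in> cube n"
    by (cases v) (auto simp: cube_def)
  have x: "xorv v (b # x) = (c \<noteq> b) # xorv w x" for b x
    by (simp add: v xorv_def)
  have "map_pmf (xorv v) (unif (Suc n)) =
      bind_pmf (map_pmf (\<lambda>b. c \<noteq> b) (bernoulli_pmf (1/2)))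
        (\<lambda>b. bind_pmf (map_pmf (xorv w) (unif n)) (\<lambda>x. return_pmf (b # x)))"
    by (simp add: map_bind_pmf bind_map_pmf x)
  also have "\<dots> = unif (Suc n)"
    by (simp only: map_neq_bernoulli_half Suc.IH[OF w] replicate_pmf.simps)
  finally show ?case .
qed

lemma prob_unif_shift:
  assumes "v \<in> cube n"
  shows "measure_pmf.prob (unif n) {y. P (xorv v y)} = measure_pmf.prob (unif n) {y. P y}"
proof -
  have "measure_pmf.prob (unif n) {y. P y} = measure_pmf.prob (map_pmf (xorv v) (unif n)) {y. P y}"
    by (simp add: map_xorv_unif[OF assms])
  then show ?thesis by (simp add: vimage_def)
qed

lemma prob_pair_pmf_invariant:
  assumes "map_pmf f A = A" "map_pmf g B = B"
  shows "measure_pmf.prob (pair_pmf A B) {(x, y). P (f x) (g y)} =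
         measure_pmf.prob (pair_pmf A B) {(x, y). P x y}"
proof -
  have "measure_pmf.prob (pair_pmf A B) {(x, y). P x y} =
    measure_pmf.prob (map_pmf (\<lambda>(a, b). (f a, g b)) (pair_pmf A B)) {(x, y). P x y}"
    by (simp only: map_pair assms)
  also have "\<dots> = measure_pmf.prob (pair_pmf A B) {(x, y). P (f x) (g y)}"
    by (simp add: vimage_def case_prod_unfold)
  finally show ?thesis ..
qed

lemma prob_pair_pmf_swap:
  "measure_pmf.prob (pair_pmf A B) {(x, y). P y x} = measure_pmf.prob (pair_pmf B A) {(x, y). P x y}"
  by (subst pair_commute_pmf) (simp add: vimage_def case_prod_unfold)

text \<open>Flipping bit \<open>i\<close> preserves the uniform distribution and exchanges the event
  with its complement.\<close>

lemma prob_unif_nth_eq: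
  assumes "i < n" "j < n" "i \<noteq> j"
  shows "measure_pmf.prob (unif n) {b. b ! i = b ! j} = 1/2"
proof -
  let ?v = "bitvec n (\<lambda>l. l = i)"
  have "measure_pmf.prob (unif n) {b. b ! i = b ! j} =
      measure_pmf.prob (unif n) {b. xorv ?v b ! i = xorv ?v b ! j}"
    by (rule prob_unif_shift[symmetric, where P = "\<lambda>b. b ! i = b ! j"]) simp
  also have "\<dots> = measure_pmf.prob (unif n) {b. \<not> b ! i = b ! j}"
    by (rule measure_pmf.finite_measure_eq_AE) (use assms in \<open>auto simp: AE_measure_pmf_iff cube_def\<close>)
  also have "\<dots> = 1 - measure_pmf.prob (unif n) {b. b ! i = b ! j}"
    by (rule prob_not)
  finally show ?thesis by simp
qed

section \<open>Testing for a literal\<close>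

text \<open>Local correction: if \<open>h\<close> is close to an affine function, this is the value
  of its linear part at \<open>u\<close> for most \<open>r\<close>. An additive constant in
  \<open>h\<close> cancels.\<close>

definition self_correct :: "(bool list \<Rightarrow> bool) \<Rightarrow> bool list \<Rightarrow> bool list \<Rightarrow> bool" where
  "self_correct h u r \<longleftrightarrow> h (xorv u r) \<noteq> h r"

text \<open>The bound is demanded for each \<open>u\<close> separately, since \<open>u\<close> will
  come from an arbitrary distribution; only \<open>r\<close> is uniform.\<close>

definition decodes :: "nat \<Rightarrow> (bool list \<Rightarrow> bool) \<Rightarrow> nat \<Rightarrow> bool" where
  "decodes n h i \<longleftrightarrow> i < n \<and>
     (\<forall>u\<in>cube n. measure_pmf.prob (unif n) {r. self_correct h u r \<noteq> u ! i} \<le> 1/4)"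

text \<open>The conjuncts test affinity of \<open>h\<close>, multiplicativity of the corrected
  values, and that the corrected value at the all-ones vector is 1, which rules out the zero map.
  The value at zero in the first conjunct admits negated literals.\<close>

definition literal_check ::
  "nat \<Rightarrow> (bool list \<Rightarrow> bool) \<Rightarrow> (bool list \<times> bool list) \<times> bool list \<Rightarrow> bool" where
  "literal_check n h = (\<lambda>((x, y), r).
     h (xorv x r) = ((h x \<noteq> h r) \<noteq> h (bitvec n (\<lambda>_. False))) \<and>
     self_correct h (andv x y) r = (self_correct h x r \<and> self_correct h y r) \<and>
     self_correct h (bitvec n (\<lambda>_. True)) r)"

abbreviation unif3 :: "nat \<Rightarrow> ((bool list \<times> bool list) \<times> bool list) pmf" where
  "unif3 n \<equiv> pair_pmf (pair_pmf (unif n) (unif n)) (unif n)"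

text \<open>Whatever the first draw is, the second disagrees with it with probability at least
  \<open>min p (1 - p)\<close>, the probability of the rarer value.\<close>

lemma prob_pair_neq_imp_almost_const:
  fixes \<phi> :: "'a \<Rightarrow> bool"
  assumes "measure_pmf.prob (pair_pmf M M) {(y, z). \<phi> y \<noteq> \<phi> z} \<le> d"
  shows "\<exists>e. measure_pmf.prob M {y. \<phi> y \<noteq> e} \<le> d"
proof -
  define p where "p = measure_pmf.prob M {y. \<phi> y}"
  have p: "measure_pmf.prob M {y. \<not> \<phi> y} = 1 - p" "0 \<le> p" "p \<le> 1"
    by (simp_all add: p_def prob_not)
  have "min p (1 - p) * measure_pmf.prob M {x. True} \<le>
      (\<integral>a. measure_pmf.prob M {b. case (a, b) of (y, z) \<Rightarrow> \<phi> y \<noteq> \<phi> z} \<partial>measure_pmf M)"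
  proof (rule integral_pmf_ge)
    fix a
    show "min p (1 - p) \<le> measure_pmf.prob M {b. case (a, b) of (y, z) \<Rightarrow> \<phi> y \<noteq> \<phi> z}"
      by (cases "\<phi> a") (simp_all add: p p_def[symmetric])
  qed (use p in auto)
  then have "min p (1 - p) \<le> d"
    using assms by (simp add: prob_pair_pmf)
  then show ?thesis
    using p by (cases "p \<le> 1 - p") (auto simp: p_def intro: exI[of _ True] exI[of _ False])
qed

text \<open>The value of \<open>h\<close> at the sum of \<open>u\<close>, \<open>y\<close> and
  \<open>z\<close> expands by additivity at \<open>(xorv u y, z)\<close> and also at
  \<open>(xorv u z, y)\<close>. Unless one expansion fails, correcting with \<open>y\<close> and
  with \<open>z\<close> gives the same result.\<close>

lemma self_correct_almost_const:
  assumes lin: "measure_pmf.prob (pair_pmf (unif n) (unif n))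
      {(x, r). h (xorv x r) \<noteq> (h x \<noteq> h r)} \<le> d"
    and u: "u \<in> cube n"
  shows "\<exists>e. measure_pmf.prob (unif n) {r. self_correct h u r \<noteq> e} \<le> 2 * d"
proof (rule prob_pair_neq_imp_almost_const)
  let ?UU = "pair_pmf (unif n) (unif n)"
  define bad where "bad x r \<longleftrightarrow> h (xorv x r) \<noteq> (h x \<noteq> h r)" for x r
  have 1: "measure_pmf.prob ?UU {(y, z). bad (xorv u y) z} \<le> d"
    using lin prob_pair_pmf_invariant[of "xorv u" "unif n" "\<lambda>x. x" "unif n" bad]
    by (simp add: map_xorv_unif u bad_def)
  have 2: "measure_pmf.prob ?UU {(y, z). bad (xorv u z) y} \<le> d"
    using 1 prob_pair_pmf_swap[of "unif n" "unif n" "\<lambda>y z. bad (xorv u y) z"] by simp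
  have "measure_pmf.prob ?UU {(y, z). self_correct h u y \<noteq> self_correct h u z} \<le>
     measure_pmf.prob ?UU {p. (case p of (y, z) \<Rightarrow> bad (xorv u y) z) \<or>
        (case p of (y, z) \<Rightarrow> bad (xorv u z) y)}"
  proof (rule prob_mono_on)
    fix p
    assume p: "p \<in> set_pmf ?UU" "case p of (y, z) \<Rightarrow> self_correct h u y \<noteq> self_correct h u z"
    obtain y z where yz: "p = (y, z)" by (cases p)
    have "xorv (xorv u y) z = xorv (xorv u z) y"
      using p u yz by (intro cube_eqI[of _ n]) (auto simp: cube_def)
    then show "(case p of (y, z) \<Rightarrow> bad (xorv u y) z) \<or> (case p of (y, z) \<Rightarrow> bad (xorv u z) y)"
      using p yz by (auto simp: bad_def self_correct_def)
  qed
  also have "\<dots> \<le> 2 * d"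
    using 1 2 prob_disj_le[of ?UU "\<lambda>(y, z). bad (xorv u y) z" "\<lambda>(y, z). bad (xorv u z) y"] by simp
  finally show "measure_pmf.prob ?UU {(y, z). self_correct h u y \<noteq> self_correct h u z} \<le> 2 * d" .
qed

text \<open>An additive map that vanishes on the basis vectors vanishes on all their prefix sums,
  the last of which is the all-ones vector.\<close>

lemma additive_imp_nonzero_on_basis:
  assumes add: "\<And>u v. u \<in> cube n \<Longrightarrow> v \<in> cube n \<Longrightarrow> g (xorv u v) = (g u \<noteq> g v)"
    and one: "g (bitvec n (\<lambda>_. True))"
  obtains i where "i < n" "g (bitvec n (\<lambda>j. j = i))"
proof -
  have "\<exists>i<n. g (bitvec n (\<lambda>j. j = i))"
  proof (rule ccontr)
    assume none: "\<not> ?thesis"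
    have "\<not> g (bitvec n (\<lambda>j. j < m))" if "m \<le> n" for m
      using that
    proof (induction m)
      case 0
      have "xorv (bitvec n (\<lambda>j. j < 0)) (bitvec n (\<lambda>j. j < 0)) = bitvec n (\<lambda>j. j < 0)"
        by (rule cube_eqI[of _ n]) (auto simp: cube_def)
      then show ?case
        using add[of "bitvec n (\<lambda>j. j < 0)" "bitvec n (\<lambda>j. j < 0)"] by auto
    next
      case (Suc m)
      have "xorv (bitvec n (\<lambda>j. j < m)) (bitvec n (\<lambda>j. j = m)) = bitvec n (\<lambda>j. j < Suc m)"
        by (rule cube_eqI[of _ n]) (auto simp: cube_def)
      then show ?case
        using add[of "bitvec n (\<lambda>j. j < m)" "bitvec n (\<lambda>j. j = m)"] Suc none by auto
    qed
    moreover have "bitvec n (\<lambda>j. j < n) = bitvec n (\<lambda>_. True)"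
      by (rule cube_eqI[of _ n]) auto
    ultimately show False using one by (metis order_refl)
  qed
  with that show thesis by blast
qed

text \<open>The self-corrected function is additive because its defining test passes often; then
  \<open>g (x \<and> y) + g x * g y\<close> is a bilinear form over the two-element field, and a nonzero one does not
  vanish with probability at least \<open>1/4\<close>. So \<open>g\<close> is a ring homomorphism, i.e. a coordinate.\<close>

lemma literal_check_sound:
  assumes pass: "measure_pmf.prob (unif3 n) {t. \<not> literal_check n h t} \<le> 1/48"
  shows "\<exists>i. decodes n h i"
proof -
  let ?U = "unif n"
  let ?UU = "pair_pmf ?U ?U"
  let ?one = "bitvec n (\<lambda>_. True)"
  define h0 where "h0 x \<longleftrightarrow> h x \<noteq> h (bitvec n (\<lambda>_. False))" for x
  have sc: "self_correct h0 = self_correct h"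
    by (auto simp: fun_eq_iff self_correct_def h0_def)
  have lin: "measure_pmf.prob ?UU {(x, r). h0 (xorv x r) \<noteq> (h0 x \<noteq> h0 r)} \<le> 1/48"
  proof -
    have "measure_pmf.prob ?UU {(x, r). h0 (xorv x r) \<noteq> (h0 x \<noteq> h0 r)} =
      measure_pmf.prob (map_pmf (\<lambda>(a, b). (fst a, b)) (unif3 n)) {(x, r). h0 (xorv x r) \<noteq> (h0 x \<noteq> h0 r)}"
      by (simp add: map_pair map_fst_pair_pmf)
    also have "\<dots> = measure_pmf.prob (unif3 n)
        {t. h0 (xorv (fst (fst t)) (snd t)) \<noteq> (h0 (fst (fst t)) \<noteq> h0 (snd t))}"
      by (simp add: vimage_def case_prod_unfold)
    also have "\<dots> \<le> measure_pmf.prob (unif3 n) {t. \<not> literal_check n h t}"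
      by (rule prob_mono_on) (auto simp: literal_check_def h0_def)
    finally show ?thesis using pass by simp
  qed
  \<comment> \<open>The rate 1/48 doubles to 1/24, so three corrections are all right except with
    probability 1/8.\<close>
  have "\<forall>u\<in>cube n. \<exists>e. measure_pmf.prob ?U {r. self_correct h u r \<noteq> e} \<le> 1/24"
    using self_correct_almost_const[OF lin] by (simp add: sc)
  then obtain g where g: "\<And>u. u \<in> cube n \<Longrightarrow>
      measure_pmf.prob ?U {r. self_correct h u r \<noteq> g u} \<le> 1/24"
    by metis
  have add: "g (xorv u v) = (g u \<noteq> g v)" if uv: "u \<in> cube n" "v \<in> cube n" for u v
  proof -
    \<comment> \<open>Correcting at \<open>u\<close> with the shifted point \<open>xorv v r\<close>
      makes the sum of the corrections at \<open>u\<close> and \<open>v\<close> telescope to the one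
      at \<open>xorv u v\<close>. A single good \<open>r\<close> suffices, as \<open>g\<close> does
      not depend on it.\<close>
    have "measure_pmf.prob ?U {r. self_correct h u (xorv v r) \<noteq> g u} \<le> 1/24"
      using g[OF uv(1)] prob_unif_shift[OF uv(2), of "\<lambda>r. self_correct h u r \<noteq> g u"] by simp
    then have "measure_pmf.prob ?U {r. self_correct h (xorv u v) r \<noteq> g (xorv u v) \<or>
        self_correct h u (xorv v r) \<noteq> g u \<or> self_correct h v r \<noteq> g v} \<le> 1/24 + (1/24 + 1/24)"
      using g[of "xorv u v"] g[of v] uv
      by (intro order_trans[OF prob_disj_le] add_mono) auto
    then have "measure_pmf.prob ?U {r. self_correct h (xorv u v) r \<noteq> g (xorv u v) \<or>
        self_correct h u (xorv v r) \<noteq> g u \<or> self_correct h v r \<noteq> g v} < 1"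
      by simp
    then obtain r where "r \<in> set_pmf ?U" "self_correct h (xorv u v) r = g (xorv u v)"
        "self_correct h u (xorv v r) = g u" "self_correct h v r = g v"
      by (rule prob_lt_1_obtains) blast
    then show ?thesis
      using uv by (auto simp: self_correct_def xorv_assoc)
  qed
  have mult: "g (andv a b) = (g a \<and> g b)" if ab: "a \<in> cube n" "b \<in> cube n" for a b
  proof (rule ccontr)
    define bad where "bad x y \<longleftrightarrow> g (andv x y) \<noteq> (g x \<and> g y)" for x y
    assume "\<not> ?thesis"
    then have "bad a b" by (simp add: bad_def)
    \<comment> \<open>The defect of multiplicativity is additive in each argument, so its four
      values here sum to the defect at \<open>(a, b)\<close>, which is 1. By translation invariance,
      bad pairs then have probability at least 1/4.\<close>
    have four: "bad x y \<or> bad (xorv a x) y \<or> bad x (xorv b y) \<or> bad (xorv a x) (xorv b y)"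
      if "x \<in> cube n" "y \<in> cube n" for x y
    proof -
      have e: "g (andv (xorv a x) y) = (g (andv a y) \<noteq> g (andv x y))"
        "g (andv x (xorv b y)) = (g (andv x b) \<noteq> g (andv x y))"
        "g (andv (xorv a x) (xorv b y)) =
          ((g (andv a b) \<noteq> g (andv x b)) \<noteq> (g (andv a y) \<noteq> g (andv x y)))"
        "g (xorv a x) = (g a \<noteq> g x)" "g (xorv b y) = (g b \<noteq> g y)"
        using that ab by (simp_all add: add andv_xorv_distrib[where n = n])
      show ?thesis
        using \<open>bad a b\<close> unfolding bad_def e by argo
    qed
    note inv = prob_pair_pmf_invariant[of _ ?U _ ?U bad]
    have "1 = measure_pmf.prob ?UU {p. True}" by simp
    also have "\<dots> \<le> measure_pmf.prob ?UU {p. (\<lambda>(x, y). bad x y) p \<or> (\<lambda>(x, y). bad (xorv a x) y) p \<or>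
        (\<lambda>(x, y). bad x (xorv b y)) p \<or> (\<lambda>(x, y). bad (xorv a x) (xorv b y)) p}"
      by (rule prob_mono_on) (use four in auto)
    also have "\<dots> \<le> measure_pmf.prob ?UU {(x, y). bad x y} + (measure_pmf.prob ?UU {(x, y). bad (xorv a x) y} +
        (measure_pmf.prob ?UU {(x, y). bad x (xorv b y)} + measure_pmf.prob ?UU {(x, y). bad (xorv a x) (xorv b y)}))"
      by (intro order_trans[OF prob_disj_le] add_left_mono order_refl)
    also have "\<dots> = 4 * measure_pmf.prob ?UU {(x, y). bad x y}"
      using inv[of "xorv a" "\<lambda>x. x"] inv[of "\<lambda>x. x" "xorv b"] inv[of "xorv a" "xorv b"] ab
      by (simp add: map_xorv_unif)
    finally have quarter: "1/4 \<le> measure_pmf.prob ?UU {(x, y). bad x y}" by simp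
    \<comment> \<open>At a bad pair the check passes only if one of three corrections is wrong,
      hence 7/8. The product of 7/8 and 1/4 exceeds 1/48.\<close>
    have "7/8 * measure_pmf.prob ?UU {p. case p of (x, y) \<Rightarrow> bad x y} \<le>
       (\<integral>p. measure_pmf.prob ?U {r. \<not> literal_check n h (p, r)} \<partial>measure_pmf ?UU)"
    proof (rule integral_pmf_ge)
      fix p assume p: "p \<in> set_pmf ?UU" "case p of (x, y) \<Rightarrow> bad x y"
      obtain x y where pxy: "p = (x, y)" by (cases p)
      then have xy: "x \<in> cube n" "y \<in> cube n" "bad x y" using p by auto
      have "measure_pmf.prob ?U {r. literal_check n h (p, r)} \<le>
        measure_pmf.prob ?U {r. self_correct h (andv x y) r \<noteq> g (andv x y) \<or>
          self_correct h x r \<noteq> g x \<or> self_correct h y r \<noteq> g y}"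
        using xy by (intro prob_mono_on) (auto simp: literal_check_def pxy bad_def)
      also have "\<dots> \<le> 1/24 + (1/24 + 1/24)"
        using g[of "andv x y"] g[of x] g[of y] xy
        by (intro order_trans[OF prob_disj_le] add_mono) auto
      finally show "7/8 \<le> measure_pmf.prob ?U {r. \<not> literal_check n h (p, r)}"
        by (simp add: prob_not)
    qed auto
    then show False
      using quarter pass by (simp add: prob_pair_pmf[of ?UU])
  qed
  have one: "g ?one"
  proof (rule ccontr)
    assume ng: "\<not> g ?one"
    have "measure_pmf.prob ?U {r. \<not> self_correct h ?one r} =
        measure_pmf.prob (map_pmf snd (unif3 n)) {r. \<not> self_correct h ?one r}"
      by (simp only: map_snd_pair_pmf)
    also have "\<dots> = measure_pmf.prob (unif3 n) {t. \<not> self_correct h ?one (snd t)}"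
      by (simp add: vimage_def)
    also have "\<dots> \<le> measure_pmf.prob (unif3 n) {t. \<not> literal_check n h t}"
      by (rule prob_mono_on) (auto simp: literal_check_def)
    finally show False
      using g[of ?one] ng pass by (simp add: prob_not)
  qed
  obtain i where i: "i < n" "g (bitvec n (\<lambda>j. j = i))"
    using additive_imp_nonzero_on_basis[OF add one] by blast
  \<comment> \<open>Multiplying \<open>u\<close> by the basis vector leaves that vector or zero,
    according to \<open>u ! i\<close>.\<close>
  have "g u = u ! i" if u: "u \<in> cube n" for u
  proof -
    have gu: "g u = g (andv u (bitvec n (\<lambda>j. j = i)))"
      using mult[OF u, of "bitvec n (\<lambda>j. j = i)"] i by simp
    show ?thesis
    proof (cases "u ! i")
      case True
      then have "andv u (bitvec n (\<lambda>j. j = i)) = bitvec n (\<lambda>j. j = i)"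
        using u by (intro cube_eqI[of _ n]) (auto simp: cube_def)
      then show ?thesis using gu True i by simp
    next
      case False
      let ?z = "bitvec n (\<lambda>_. False)"
      have "andv u (bitvec n (\<lambda>j. j = i)) = ?z" "xorv ?z ?z = ?z"
        using u False by (auto intro!: cube_eqI[of _ n] simp: cube_def)
      then show ?thesis using gu False add[of ?z ?z] by auto
    qed
  qed
  then have "decodes n h i"
    using g i by (force simp: decodes_def)
  then show ?thesis ..
qed

text \<open>The offset \<open>c\<close> enters each conjunct an even number of times and
  cancels.\<close>

lemma literal_check_complete:
  assumes "\<And>x. x \<in> cube n \<Longrightarrow> h x = (x ! i \<noteq> c)" "i < n"
    and "t \<in> set_pmf (unif3 n)"
  shows "literal_check n h t"
proof -
  obtain x y r where t: "t = ((x, y), r)" and xyr: "x \<in> cube n" "y \<in> cube n" "r \<in> cube n"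
    using assms(3) by auto
  have nth: "xorv a b ! i = (a ! i \<noteq> b ! i)" "andv a b ! i = (a ! i \<and> b ! i)"
    if "a \<in> cube n" "b \<in> cube n" for a b
    using that assms(2) by (auto simp: cube_def)
  show ?thesis
    using xyr assms(2) by (auto simp: t literal_check_def self_correct_def assms(1) nth)
qed

section \<open>Building blocks of oracle algorithms\<close>

text \<open>Halting in \<open>alg\<close> yields only a verdict, so a procedure that delivers a
  value takes a continuation.\<close>

primrec repeat_draw :: "nat \<Rightarrow> (('a \<Rightarrow> alg) \<Rightarrow> alg) \<Rightarrow> ('a list \<Rightarrow> alg) \<Rightarrow> alg" where
  "repeat_draw 0 d c = c []"
| "repeat_draw (Suc m) d c = d (\<lambda>x. repeat_draw m d (\<lambda>xs. c (x # xs)))"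

definition pair_draw ::
  "(('a \<Rightarrow> alg) \<Rightarrow> alg) \<Rightarrow> (('b \<Rightarrow> alg) \<Rightarrow> alg) \<Rightarrow> ('a \<times> 'b \<Rightarrow> alg) \<Rightarrow> alg" where
  "pair_draw d e c = d (\<lambda>x. e (\<lambda>y. c (x, y)))"

abbreviation coins :: "nat \<Rightarrow> (bool list \<Rightarrow> alg) \<Rightarrow> alg" where
  "coins n \<equiv> repeat_draw n Coin"

text \<open>The continuation of \<open>asks\<close> receives the answers as a function that is correct on the queried
  points and junk elsewhere.\<close>

primrec asks :: "bool list list \<Rightarrow> ((bool list \<Rightarrow> bool) \<Rightarrow> alg) \<Rightarrow> alg" where
  "asks [] c = c (\<lambda>_. False)"
| "asks (x # xs) c = Query x (\<lambda>b. asks xs (\<lambda>g. c (g(x := b))))"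

primrec bisect :: "nat \<Rightarrow> (nat \<Rightarrow> bool list) \<Rightarrow> bool \<Rightarrow> nat \<Rightarrow> (nat \<Rightarrow> alg) \<Rightarrow> alg" where
  "bisect 0 a b lo c = c lo"
| "bisect (Suc m) a b lo c =
     Query (a (lo + 2 ^ m)) (\<lambda>v. if v = b then bisect m a b (lo + 2 ^ m) c else bisect m a b lo c)"

definition draws ::
  "(bool list \<Rightarrow> bool) \<Rightarrow> bool list pmf \<Rightarrow> (('a \<Rightarrow> alg) \<Rightarrow> alg) \<Rightarrow> 'a pmf \<Rightarrow> bool" where
  "draws f D d p \<longleftrightarrow> (\<forall>c. run (d c) f D = bind_pmf p (\<lambda>x. run (c x) f D))"

lemma draws_Sample: "draws f D Sample D"
  by (simp add: draws_def)

lemma draws_Coin: "draws f D Coin (bernoulli_pmf (1/2))"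
  by (simp add: draws_def)

lemma draws_repeat: "draws f D d p \<Longrightarrow> draws f D (repeat_draw m d) (replicate_pmf m p)"
proof (induction m)
  case (Suc m)
  then show ?case
    by (simp add: draws_def bind_assoc_pmf bind_return_pmf)
qed (simp add: draws_def bind_return_pmf)

lemma draws_pair: "draws f D d p \<Longrightarrow> draws f D e q \<Longrightarrow> draws f D (pair_draw d e) (pair_pmf p q)"
  by (simp add: draws_def pair_draw_def pair_pmf_def bind_assoc_pmf bind_return_pmf)

lemmas draws_intros = draws_Sample draws_Coin draws_repeat draws_pair

lemma run_asksI:
  assumes "\<And>g. (\<And>x. x \<in> set xs \<Longrightarrow> g x = f x) \<Longrightarrow> run (c g) f D = M"
  shows "run (asks xs c) f D = M"
proof -
  have "run (asks xs c) f D = run (c (\<lambda>x. x \<in> set xs \<and> f x)) f D" for c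
  proof (induction xs arbitrary: c)
    case (Cons x xs)
    have "(\<lambda>y. y \<in> set xs \<and> f y)(x := f x) = (\<lambda>y. y \<in> set (x # xs) \<and> f y)"
      by (auto simp: fun_eq_iff)
    with Cons show ?case by simp
  qed simp
  with assms show ?thesis by simp
qed

text \<open>Each step keeps the half whose left end has value \<open>b\<close> and whose right end
  has not. An index is returned in any case, which is all that soundness needs.\<close>

lemma run_bisect:
  "\<exists>i. run (bisect m a b lo c) f D = run (c i) f D \<and>
     (f (a lo) = b \<and> f (a (lo + 2 ^ m)) \<noteq> b \<longrightarrow> f (a i) = b \<and> f (a (Suc i)) \<noteq> b)"
proof (induction m arbitrary: lo)
  case 0
  then show ?case by auto
next
  case (Suc m)
  have eq: "lo + 2 ^ m + 2 ^ m = lo + 2 ^ Suc m" by simp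
  show ?case
    using Suc[of "lo + 2 ^ m", unfolded eq] Suc[of lo]
    by (cases "f (a (lo + 2 ^ m)) = b") (auto simp del: power_Suc)
qed

section \<open>Counting the queries of the building blocks\<close>

lemma queries_le_mono: "queries_le A m \<Longrightarrow> m \<le> m' \<Longrightarrow> queries_le A m'"
proof (induction A arbitrary: m m')
  case (Query x c)
  have "queries_le (c b) (m - 1)" "m - 1 \<le> m' - 1" for b
    using Query.prems by auto
  then have "queries_le (c b) (m' - 1)" for b
    using Query.IH by blast
  with Query.prems show ?case by auto
qed (simp_all, blast+)

text \<open>\<open>P\<close> holds for every possible result; mostly it fixes lengths, on which the
  number of later queries depends.\<close>

definition query_free :: "('a \<Rightarrow> bool) \<Rightarrow> (('a \<Rightarrow> alg) \<Rightarrow> alg) \<Rightarrow> bool" where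
  "query_free P d \<longleftrightarrow> (\<forall>c m. (\<forall>x. P x \<longrightarrow> queries_le (c x) m) \<longrightarrow> queries_le (d c) m)"

lemma query_freeD:
  "query_free P d \<Longrightarrow> (\<And>x. P x \<Longrightarrow> queries_le (c x) m) \<Longrightarrow> queries_le (d c) m"
  by (auto simp: query_free_def)

lemma query_free_Sample: "query_free (\<lambda>_. True) Sample"
  by (simp add: query_free_def)

lemma query_free_Coin: "query_free (\<lambda>_. True) Coin"
  by (simp add: query_free_def)

lemma query_free_repeat:
  assumes "query_free P d"
  shows "query_free (\<lambda>xs. length xs = m \<and> (\<forall>x\<in>set xs. P x)) (repeat_draw m d)"
proof (induction m)
  case (Suc m)
  show ?case
    unfolding query_free_def
  proof (intro allI impI)
    fix c q assume c: "\<forall>xs. length xs = Suc m \<and> (\<forall>x\<in>set xs. P x) \<longrightarrow> queries_le (c xs) q"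
    have "queries_le (repeat_draw m d (\<lambda>xs. c (x # xs))) q" if "P x" for x
      using c that by (intro query_freeD[OF Suc]) auto
    then show "queries_le (repeat_draw (Suc m) d c) q"
      by (simp add: query_freeD[OF assms])
  qed
qed (simp add: query_free_def)

lemma query_free_pair:
  assumes "query_free P d" "query_free Q e"
  shows "query_free (\<lambda>(x, y). P x \<and> Q y) (pair_draw d e)"
  using assms by (auto simp: query_free_def pair_draw_def)

lemma length_concat_map_const:
  "(\<And>x. x \<in> set xs \<Longrightarrow> length (h x) = c) \<Longrightarrow> length (concat (map h xs)) = length xs * c"
  by (induction xs) auto

lemma queries_le_asks:
  "(\<And>g. queries_le (c g) m) \<Longrightarrow> queries_le (asks xs c) (length xs + m)"
  by (induction xs arbitrary: c) auto

lemma queries_le_bisect: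
  "(\<And>i. queries_le (c i) q) \<Longrightarrow> queries_le (bisect m a b lo c) (m + q)"
  by (induction m arbitrary: lo) auto

section \<open>The tester for a fixed partition into blocks\<close>

text \<open>\<open>blk\<close> sends coordinates to blocks, meant to be numbered below
  \<open>2 ^ m\<close>, so that \<open>m\<close> is the bisection depth. A round takes
  \<open>t\<close> samples with \<open>s\<close> decoding points each; a new block undergoes
  \<open>s'\<close> literal checks.\<close>

locale block_tester =
  fixes n :: nat and blk :: "nat \<Rightarrow> nat" and m t s s' :: nat
begin

text \<open>A found block is a pair of its index and a witness; the block function varies the block
  and keeps the witness elsewhere.\<close>

definition mix :: "nat \<times> bool list \<Rightarrow> bool list \<Rightarrow> bool list" where
  "mix e x = bitvec n (\<lambda>i. if blk i = fst e then x ! i else snd e ! i)"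

definition block_fun :: "(bool list \<Rightarrow> bool) \<Rightarrow> nat \<times> bool list \<Rightarrow> bool list \<Rightarrow> bool" where
  "block_fun g e x = g (mix e x)"

text \<open>At \<open>i = 0\<close> everything outside the found blocks is zeroed; increasing
  \<open>i\<close> restores \<open>u\<close> block by block.\<close>

definition hybrid :: "(nat \<times> bool list) list \<Rightarrow> bool list \<Rightarrow> nat \<Rightarrow> bool list" where
  "hybrid L u i = bitvec n (\<lambda>j. (blk j \<in> fst ` set L \<or> blk j < i) \<and> u ! j)"

text \<open>The existential gives a meaning even to lists that repeat a block index, which the
  soundness proof does not exclude.\<close>

definition point :: "(nat \<times> bool list) list \<Rightarrow> (nat \<times> bool list \<Rightarrow> bool) \<Rightarrow> bool list" where
  "point L y = bitvec n (\<lambda>j. \<exists>e\<in>set L. fst e = blk j \<and> y e)"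

definition decode :: "(bool list \<Rightarrow> bool) \<Rightarrow> bool list \<Rightarrow> bool list \<Rightarrow> nat \<times> bool list \<Rightarrow> bool" where
  "decode g u z e = self_correct (block_fun g e) u z"

definition unanimous ::
  "(bool list \<Rightarrow> bool) \<Rightarrow> (nat \<times> bool list) list \<Rightarrow> bool list \<times> bool list list \<Rightarrow> bool" where
  "unanimous g L = (\<lambda>(u, zs). \<forall>e\<in>set L. \<forall>z\<in>set zs. decode g u z e = decode g u (hd zs) e)"

definition guess ::
  "(bool list \<Rightarrow> bool) \<Rightarrow> (nat \<times> bool list) list \<Rightarrow> bool list \<times> bool list list \<Rightarrow> bool list" where
  "guess g L = (\<lambda>(u, zs). point L (decode g u (hd zs)))"

definition consistent ::
  "(bool list \<Rightarrow> bool) \<Rightarrow> (nat \<times> bool list) list \<Rightarrow> bool list \<times> bool list list \<Rightarrow> bool" where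
  "consistent g L \<tau> \<longleftrightarrow> unanimous g L \<tau> \<and> g (guess g L \<tau>) = g (fst \<tau>)"

definition decode_queries ::
  "(nat \<times> bool list) list \<Rightarrow> bool list \<times> bool list list \<Rightarrow> bool list list" where
  "decode_queries L = (\<lambda>(u, zs).
     concat (map (\<lambda>e. concat (map (\<lambda>z. [mix e (xorv u z), mix e z]) zs)) L))"

text \<open>These are all points at which \<open>literal_check\<close> evaluates the block function;
  \<open>y\<close> and \<open>andv x y\<close> occur there only shifted by \<open>r\<close>.\<close>

definition literal_queries ::
  "nat \<times> bool list \<Rightarrow> (bool list \<times> bool list) \<times> bool list \<Rightarrow> bool list list" where
  "literal_queries e = (\<lambda>((x, y), r). map (mix e)
     [xorv x r, x, r, bitvec n (\<lambda>_. False), xorv (andv x y) r, xorv y r, xorv (bitvec n (\<lambda>_. True)) r])"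

definition extend ::
  "((nat \<times> bool list) list \<Rightarrow> alg) \<Rightarrow> (nat \<times> bool list) list \<Rightarrow> nat \<times> bool list \<Rightarrow> alg" where
  "extend next L e = repeat_draw s' (pair_draw (pair_draw (coins n) (coins n)) (coins n)) (\<lambda>T.
     asks (concat (map (literal_queries e) T)) (\<lambda>g.
       if \<forall>t\<in>set T. literal_check n (block_fun g e) t then next (e # L) else Reject))"

text \<open>The guessed points depend on decoded answers, hence the further batch with answers
  \<open>g'\<close>. After a mismatch, the hybrid just past the change found by bisection becomes
  the witness.\<close>

definition process ::
  "((nat \<times> bool list) list \<Rightarrow> alg) \<Rightarrow> (nat \<times> bool list) list \<Rightarrow>
   (bool list \<times> bool list list) list \<Rightarrow> alg" where
  "process next L \<omega> = asks (concat (map (\<lambda>\<tau>. [fst \<tau>, hybrid L (fst \<tau>) 0]) \<omega>)) (\<lambda>g.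
     case find (\<lambda>\<tau>. g (fst \<tau>) \<noteq> g (hybrid L (fst \<tau>) 0)) \<omega> of
       None \<Rightarrow> asks (concat (map (decode_queries L) \<omega>)) (\<lambda>g.
         asks (concat (map (\<lambda>\<tau>. [fst \<tau>, guess g L \<tau>]) \<omega>)) (\<lambda>g'.
           if \<forall>\<tau>\<in>set \<omega>. unanimous g L \<tau> \<and> g' (guess g L \<tau>) = g' (fst \<tau>) then Accept else Reject))
     | Some \<tau> \<Rightarrow> bisect m (hybrid L (fst \<tau>)) (g (hybrid L (fst \<tau>) 0)) 0
         (\<lambda>i. extend next L (i, hybrid L (fst \<tau>) (Suc i))))"

definition round :: "((nat \<times> bool list) list \<Rightarrow> alg) \<Rightarrow> (nat \<times> bool list) list \<Rightarrow> alg" where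
  "round next L = repeat_draw t (pair_draw Sample (repeat_draw s (coins n))) (process next L)"

definition tester :: "nat \<Rightarrow> (nat \<times> bool list) list \<Rightarrow> alg" where
  "tester j = (round ^^ j) (\<lambda>_. Reject)"

abbreviation trials :: "bool list pmf \<Rightarrow> (bool list \<times> bool list list) list pmf" where
  "trials D \<equiv> replicate_pmf t (pair_pmf D (replicate_pmf s (unif n)))"

section \<open>Output distributions of the procedures in a round\<close>

lemma mix_in_cube [simp]: "mix e x \<in> cube n" and hybrid_in_cube [simp]: "hybrid L u i \<in> cube n"
  and point_in_cube [simp]: "point L y \<in> cube n"
  by (simp_all add: mix_def hybrid_def point_def)

lemma run_extend:
  "run (extend next L e) f D = bind_pmf (replicate_pmf s' (unif3 n)) (\<lambda>T.
     if \<forall>t\<in>set T. literal_check n (block_fun f e) t then run (next (e # L)) f D else return_pmf False)"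
proof -
  have "draws f D (repeat_draw s' (pair_draw (pair_draw (coins n) (coins n)) (coins n)))
      (replicate_pmf s' (unif3 n))"
    by (intro draws_intros)
  then show ?thesis
    unfolding extend_def draws_def
  proof (simp, intro bind_pmf_cong refl run_asksI)
    fix T g assume g: "\<And>x. x \<in> set (concat (map (literal_queries e) T)) \<Longrightarrow> g x = f x"
    have "literal_check n (block_fun g e) t = literal_check n (block_fun f e) t" if "t \<in> set T" for t
    proof -
      have "\<forall>x\<in>set (literal_queries e t). g x = f x"
        using that g by auto
      then show ?thesis
        by (auto simp: literal_queries_def literal_check_def self_correct_def block_fun_def
            split: prod.splits)
    qed
    then show "run (if \<forall>t\<in>set T. literal_check n (block_fun g e) t then next (e # L) else Reject) f D =
      (if \<forall>t\<in>set T. literal_check n (block_fun f e) t then run (next (e # L)) f D else return_pmf False)"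
      by auto
  qed
qed

lemma run_round: "run (round next L) f D = bind_pmf (trials D) (\<lambda>\<omega>. run (process next L \<omega>) f D)"
proof -
  have "draws f D (repeat_draw t (pair_draw Sample (repeat_draw s (coins n)))) (trials D)"
    by (intro draws_intros)
  then show ?thesis
    by (simp add: round_def draws_def)
qed

text \<open>Decoding points must exist so that the \<open>hd\<close> read by \<open>guess\<close> is
  among the queried ones.\<close>

lemma run_process_no_mismatch:
  assumes "\<forall>\<tau>\<in>set \<omega>. f (fst \<tau>) = f (hybrid L (fst \<tau>) 0)" "\<forall>\<tau>\<in>set \<omega>. snd \<tau> \<noteq> []"
  shows "run (process next L \<omega>) f D = return_pmf (\<forall>\<tau>\<in>set \<omega>. consistent f L \<tau>)"
  unfolding process_def
proof (rule run_asksI)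
  fix g assume g: "\<And>x. x \<in> set (concat (map (\<lambda>\<tau>. [fst \<tau>, hybrid L (fst \<tau>) 0]) \<omega>)) \<Longrightarrow> g x = f x"
  have "g (fst \<tau>) = g (hybrid L (fst \<tau>) 0)" if "\<tau> \<in> set \<omega>" for \<tau>
    using g[of "fst \<tau>"] g[of "hybrid L (fst \<tau>) 0"] assms(1) that by auto
  then have "find (\<lambda>\<tau>. g (fst \<tau>) \<noteq> g (hybrid L (fst \<tau>) 0)) \<omega> = None"
    unfolding find_None_iff by blast
  moreover have "run (asks (concat (map (decode_queries L) \<omega>)) (\<lambda>g.
         asks (concat (map (\<lambda>\<tau>. [fst \<tau>, guess g L \<tau>]) \<omega>)) (\<lambda>g'.
           if \<forall>\<tau>\<in>set \<omega>. unanimous g L \<tau> \<and> g' (guess g L \<tau>) = g' (fst \<tau>) then Accept else Reject))) f D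
       = return_pmf (\<forall>\<tau>\<in>set \<omega>. consistent f L \<tau>)"
  proof (rule run_asksI, rule run_asksI)
    fix g g'
    assume g: "\<And>x. x \<in> set (concat (map (decode_queries L) \<omega>)) \<Longrightarrow> g x = f x"
      and g': "\<And>x. x \<in> set (concat (map (\<lambda>\<tau>. [fst \<tau>, guess g L \<tau>]) \<omega>)) \<Longrightarrow> g' x = f x"
    have eq: "unanimous g L \<tau> = unanimous f L \<tau>" "guess g L \<tau> = guess f L \<tau>" if \<tau>: "\<tau> \<in> set \<omega>" for \<tau>
    proof -
      obtain u zs where uzs: "\<tau> = (u, zs)" by (cases \<tau>)
      have q: "\<forall>x\<in>set (decode_queries L \<tau>). g x = f x"
        using \<tau> g by auto
      have d: "decode g u z e = decode f u z e" if "e \<in> set L" "z \<in> set zs" for z e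
        using q that by (auto simp: uzs decode_queries_def decode_def self_correct_def block_fun_def)
      have hd: "hd zs \<in> set zs"
        using \<tau> assms(2) uzs by force
      show "unanimous g L \<tau> = unanimous f L \<tau>" "guess g L \<tau> = guess f L \<tau>"
        using d hd by (auto simp: uzs unanimous_def guess_def point_def cong: conj_cong)
    qed
    have "g' (guess g L \<tau>) = f (guess f L \<tau>)" "g' (fst \<tau>) = f (fst \<tau>)" if "\<tau> \<in> set \<omega>" for \<tau>
      using g'[of "guess g L \<tau>"] g'[of "fst \<tau>"] eq that by auto
    with eq show "run (if \<forall>\<tau>\<in>set \<omega>. unanimous g L \<tau> \<and> g' (guess g L \<tau>) = g' (fst \<tau>)
        then Accept else Reject) f D = return_pmf (\<forall>\<tau>\<in>set \<omega>. consistent f L \<tau>)"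
      by (auto simp: consistent_def)
  qed
  ultimately show "run (case find (\<lambda>\<tau>. g (fst \<tau>) \<noteq> g (hybrid L (fst \<tau>) 0)) \<omega> of
       None \<Rightarrow> asks (concat (map (decode_queries L) \<omega>)) (\<lambda>g.
         asks (concat (map (\<lambda>\<tau>. [fst \<tau>, guess g L \<tau>]) \<omega>)) (\<lambda>g'.
           if \<forall>\<tau>\<in>set \<omega>. unanimous g L \<tau> \<and> g' (guess g L \<tau>) = g' (fst \<tau>) then Accept else Reject))
     | Some \<tau> \<Rightarrow> bisect m (hybrid L (fst \<tau>)) (g (hybrid L (fst \<tau>) 0)) 0
         (\<lambda>i. extend next L (i, hybrid L (fst \<tau>) (Suc i)))) f D =
     return_pmf (\<forall>\<tau>\<in>set \<omega>. consistent f L \<tau>)"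
    by simp
qed

text \<open>Soundness uses only that the run goes on with some block. For juntas the full hybrid
  equals the sample, and the implication yields a genuine change of value at
  \<open>i\<close>.\<close>

lemma run_process_mismatch:
  assumes "\<exists>\<tau>\<in>set \<omega>. f (fst \<tau>) \<noteq> f (hybrid L (fst \<tau>) 0)"
  shows "\<exists>\<tau>\<in>set \<omega>. \<exists>i. run (process next L \<omega>) f D =
      run (extend next L (i, hybrid L (fst \<tau>) (Suc i))) f D \<and>
      (f (hybrid L (fst \<tau>) (2 ^ m)) = f (fst \<tau>) \<longrightarrow>
         f (hybrid L (fst \<tau>) i) \<noteq> f (hybrid L (fst \<tau>) (Suc i)))"
proof -
  let ?mis = "\<lambda>\<tau>. f (fst \<tau>) \<noteq> f (hybrid L (fst \<tau>) 0)"
  obtain \<tau> where \<tau>: "find ?mis \<omega> = Some \<tau>"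
    using assms by (cases "find ?mis \<omega>") (auto simp: find_None_iff)
  then have mem: "\<tau> \<in> set \<omega>" and mis: "?mis \<tau>"
    by (auto simp: find_Some_iff)
  obtain i where i: "run (bisect m (hybrid L (fst \<tau>)) (f (hybrid L (fst \<tau>) 0)) 0
         (\<lambda>i. extend next L (i, hybrid L (fst \<tau>) (Suc i)))) f D =
         run (extend next L (i, hybrid L (fst \<tau>) (Suc i))) f D"
      "f (hybrid L (fst \<tau>) (0 + 2 ^ m)) \<noteq> f (hybrid L (fst \<tau>) 0) \<longrightarrow>
         f (hybrid L (fst \<tau>) i) = f (hybrid L (fst \<tau>) 0) \<and>
         f (hybrid L (fst \<tau>) (Suc i)) \<noteq> f (hybrid L (fst \<tau>) 0)"
    using run_bisect[of m "hybrid L (fst \<tau>)" "f (hybrid L (fst \<tau>) 0)" 0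
        "\<lambda>i. extend next L (i, hybrid L (fst \<tau>) (Suc i))" f D] by auto
  have "run (process next L \<omega>) f D = run (extend next L (i, hybrid L (fst \<tau>) (Suc i))) f D"
    unfolding process_def
  proof (rule run_asksI)
    fix g assume g: "\<And>x. x \<in> set (concat (map (\<lambda>\<tau>. [fst \<tau>, hybrid L (fst \<tau>) 0]) \<omega>)) \<Longrightarrow> g x = f x"
    have "find (\<lambda>\<tau>. g (fst \<tau>) \<noteq> g (hybrid L (fst \<tau>) 0)) \<omega> = find ?mis \<omega>"
      using g by (intro find_cong refl) auto
    moreover have "g (hybrid L (fst \<tau>) 0) = f (hybrid L (fst \<tau>) 0)"
      using g mem by auto
    ultimately show "run (case find (\<lambda>\<tau>. g (fst \<tau>) \<noteq> g (hybrid L (fst \<tau>) 0)) \<omega> of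
       None \<Rightarrow> asks (concat (map (decode_queries L) \<omega>)) (\<lambda>g.
         asks (concat (map (\<lambda>\<tau>. [fst \<tau>, guess g L \<tau>]) \<omega>)) (\<lambda>g'.
           if \<forall>\<tau>\<in>set \<omega>. unanimous g L \<tau> \<and> g' (guess g L \<tau>) = g' (fst \<tau>) then Accept else Reject))
     | Some \<tau> \<Rightarrow> bisect m (hybrid L (fst \<tau>)) (g (hybrid L (fst \<tau>) 0)) 0
         (\<lambda>i. extend next L (i, hybrid L (fst \<tau>) (Suc i)))) f D =
      run (extend next L (i, hybrid L (fst \<tau>) (Suc i))) f D"
      using i(1) \<tau> by simp
  qed
  with i(2) mem mis show ?thesis by auto
qed

subsection \<open>Number of queries\<close>

lemma queries_le_extend:
  assumes "queries_le (next (e # L)) q"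
  shows "queries_le (extend next L e) (7 * s' + q)"
  unfolding extend_def
proof (rule query_freeD[OF query_free_repeat[OF query_free_pair[OF query_free_pair]]])
  fix T :: "((bool list \<times> bool list) \<times> bool list) list"
  assume T: "length T = s' \<and> (\<forall>x\<in>set T. case x of (x, y) \<Rightarrow>
    (case x of (x, y) \<Rightarrow> (length x = n \<and> (\<forall>x\<in>set x. True)) \<and> length y = n \<and> (\<forall>x\<in>set y. True)) \<and>
    length y = n \<and> (\<forall>x\<in>set y. True))"
  have "length (concat (map (literal_queries e) T)) = 7 * s'"
    using T by (subst length_concat_map_const[where c = 7]) (auto simp: literal_queries_def)
  then show "queries_le (asks (concat (map (literal_queries e) T)) (\<lambda>g.
      if \<forall>t\<in>set T. literal_check n (block_fun g e) t then next (e # L) else Reject)) (7 * s' + q)"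
    using assms queries_le_asks[where m = q and xs = "concat (map (literal_queries e) T)"] by simp
qed (intro query_free_repeat query_free_Coin)+

text \<open>A run either decodes and halts or continues with budget \<open>q\<close>. As
  \<open>q\<close> covers the cost of decoding, this cost is not added anew in every round.\<close>

lemma queries_le_process:
  assumes "\<And>e. queries_le (next (e # L)) q" "length \<omega> = t" "\<And>\<tau>. \<tau> \<in> set \<omega> \<Longrightarrow> length (snd \<tau>) = s"
    and "length L \<le> k" "2 * k * s * t + 2 * t \<le> q"
  shows "queries_le (process next L \<omega>) (2 * t + (m + 7 * s' + q))"
proof -
  have l1: "length (concat (map (\<lambda>\<tau>. [fst \<tau>, h \<tau>]) \<omega>)) = 2 * t" for h
    using assms(2) by (subst length_concat_map_const[where c = 2]) auto
  have "length (decode_queries L \<tau>) = length L * (s * 2)" if "\<tau> \<in> set \<omega>" for \<tau>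
  proof -
    have "length (snd \<tau>) = s" using assms(3) that by simp
    then show ?thesis
      unfolding decode_queries_def case_prod_unfold
      by (subst length_concat_map_const[where c = "s * 2"], subst length_concat_map_const[where c = 2]) auto
  qed
  then have "length (concat (map (decode_queries L) \<omega>)) = t * (length L * (s * 2))"
    using assms(2) by (subst length_concat_map_const) auto
  also have "\<dots> \<le> t * (k * (s * 2))"
    using assms(4) by (intro mult_le_mono) auto
  finally have l2: "length (concat (map (decode_queries L) \<omega>)) \<le> 2 * k * s * t"
    by (simp add: mult_ac)
  have final: "queries_le (asks (concat (map (\<lambda>\<tau>. [fst \<tau>, guess g L \<tau>]) \<omega>)) (\<lambda>g'.
        if \<forall>\<tau>\<in>set \<omega>. unanimous g L \<tau> \<and> g' (guess g L \<tau>) = g' (fst \<tau>) then Accept else Reject)) (2 * t)" for g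
    using queries_le_asks[where m = 0 and xs = "concat (map (\<lambda>\<tau>. [fst \<tau>, guess g L \<tau>]) \<omega>)"]
    by (simp only: l1) simp
  have none: "queries_le (asks (concat (map (decode_queries L) \<omega>)) (\<lambda>g.
         asks (concat (map (\<lambda>\<tau>. [fst \<tau>, guess g L \<tau>]) \<omega>)) (\<lambda>g'.
           if \<forall>\<tau>\<in>set \<omega>. unanimous g L \<tau> \<and> g' (guess g L \<tau>) = g' (fst \<tau>) then Accept else Reject)))
         (m + 7 * s' + q)"
    by (rule queries_le_mono[OF queries_le_asks[OF final]]) (use l2 assms(5) in simp)
  have ext: "queries_le (extend next L e) (7 * s' + q)" for e
    by (rule queries_le_extend) (rule assms(1))
  have some: "queries_le (bisect m a b 0 (\<lambda>i. extend next L (i, w i)))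
         (m + 7 * s' + q)" for a b w
    by (rule queries_le_mono[OF queries_le_bisect[OF ext]]) simp
  show ?thesis
    unfolding process_def l1[symmetric, of "\<lambda>\<tau>. hybrid L (fst \<tau>) 0"]
    by (rule queries_le_asks) (use none some in \<open>auto simp: l1 split: option.splits\<close>)
qed

text \<open>The invariant leaves at most \<open>k\<close> blocks to decode in any round that is
  still run.\<close>

lemma queries_le_tester:
  "length L + j \<le> k + 1 \<Longrightarrow>
   queries_le (tester j L) (j * (2 * t + m + 7 * s') + (2 * k * s * t + 2 * t))"
proof (induction j arbitrary: L)
  case 0
  then show ?case by (simp add: tester_def)
next
  case (Suc j)
  let ?q = "j * (2 * t + m + 7 * s') + (2 * k * s * t + 2 * t)"
  have "queries_le (round (tester j) L) (2 * t + (m + 7 * s' + ?q))"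
    unfolding round_def
  proof (rule query_freeD[OF query_free_repeat[OF query_free_pair]])
    fix \<omega> :: "(bool list \<times> bool list list) list"
    assume \<omega>: "length \<omega> = t \<and> (\<forall>x\<in>set \<omega>. case x of (x, y) \<Rightarrow>
      True \<and> length y = s \<and> (\<forall>x\<in>set y. length x = n \<and> (\<forall>x\<in>set x. True)))"
    show "queries_le (process (tester j) L \<omega>) (2 * t + (m + 7 * s' + ?q))"
      by (rule queries_le_process[where k = k]) (use Suc \<omega> in auto)
  qed (intro query_free_repeat query_free_Sample query_free_Coin)+
  then show ?case by (simp add: tester_def algebra_simps)
qed

subsection \<open>Soundness\<close>

lemma prob_consistent_le:
  assumes decode: "\<And>e. e \<in> set L \<Longrightarrow> \<exists>i. decodes n (block_fun f e) i"
    and len: "length L \<le> k" and small: "real k * (1/4) ^ s \<le> 1/2"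
    and D: "set_pmf D \<subseteq> cube n" and far: "far_from_juntas n k eps D f"
  shows "measure_pmf.prob (pair_pmf D (replicate_pmf s (unif n))) {\<tau>. consistent f L \<tau>} \<le> 1 - eps/2"
proof -
  obtain v where v: "\<And>e. e \<in> set L \<Longrightarrow> decodes n (block_fun f e) (v e)"
    using decode by metis
  \<comment> \<open>\<open>G\<close> compares with what error-free decoding would give; it reads
    only the coordinates \<open>v e\<close>.\<close>
  define G where "G u = f (point L (\<lambda>e. u ! v e))" for u
  have "is_junta n k G"
    unfolding is_junta_def
  proof (intro exI[of _ "v ` set L"] conjI ballI impI)
    show "v ` set L \<subseteq> {..<n}"
      using v by (auto simp: decodes_def)
    show "card (v ` set L) \<le> k"
      using len card_image_le[of "set L" v] card_length[of L] by simp
    fix x y :: "bool list" assume "\<forall>i\<in>v ` set L. x ! i = y ! i"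
    then have "point L (\<lambda>e. x ! v e) = point L (\<lambda>e. y ! v e)"
      by (auto simp: point_def cong: conj_cong)
    then show "G x = G y" by (simp add: G_def)
  qed
  with far have eps: "eps \<le> measure_pmf.prob D {u. f u \<noteq> G u}"
    by (simp add: far_from_juntas_def)
  have "1/2 * measure_pmf.prob D {u. f u \<noteq> G u} \<le>
      (\<integral>u. measure_pmf.prob (replicate_pmf s (unif n)) {zs. \<not> consistent f L (u, zs)} \<partial>measure_pmf D)"
  proof (rule integral_pmf_ge)
    fix u assume "u \<in> set_pmf D" and ne: "f u \<noteq> G u"
    then have u: "u \<in> cube n" using D by auto
    \<comment> \<open>If every block had a correct answer, unanimity would make all answers correct
      and turn the comparison into \<open>f u = G u\<close>. So some block is decoded wrongly at all
      \<open>s\<close> points.\<close>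
    have "measure_pmf.prob (replicate_pmf s (unif n)) {zs. consistent f L (u, zs)} \<le>
        measure_pmf.prob (replicate_pmf s (unif n)) {zs. \<exists>e\<in>set L. \<forall>z\<in>set zs. decode f u z e \<noteq> u ! v e}"
    proof (rule prob_mono_on, rule ccontr)
      fix zs assume zs: "zs \<in> set_pmf (replicate_pmf s (unif n))" and c: "consistent f L (u, zs)"
        and right: "\<not> (\<exists>e\<in>set L. \<forall>z\<in>set zs. decode f u z e \<noteq> u ! v e)"
      have "decode f u (hd zs) e = u ! v e" if "e \<in> set L" for e
        using c right that by (auto simp: consistent_def unanimous_def)
      then have "guess f L (u, zs) = point L (\<lambda>e. u ! v e)"
        by (auto simp: guess_def point_def cong: conj_cong)
      then show False
        using c ne by (simp add: consistent_def G_def)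
    qed
    also have "\<dots> \<le> real (length L) * (1/4) ^ s"
    proof (rule prob_Bex_list_le)
      fix e assume "e \<in> set L"
      then have "measure_pmf.prob (unif n) {z. decode f u z e \<noteq> u ! v e} \<le> 1/4"
        using v u by (auto simp: decodes_def decode_def)
      then show "measure_pmf.prob (replicate_pmf s (unif n))
          {zs. \<forall>z\<in>set zs. decode f u z e \<noteq> u ! v e} \<le> (1/4) ^ s"
        unfolding prob_replicate_all by (intro power_mono) auto
    qed
    also have "\<dots> \<le> real k * (1/4) ^ s"
      using len by (intro mult_right_mono) auto
    finally show "1/2 \<le> measure_pmf.prob (replicate_pmf s (unif n)) {zs. \<not> consistent f L (u, zs)}"
      using small by (simp add: prob_not)
  qed auto
  then have "eps/2 \<le> measure_pmf.prob (pair_pmf D (replicate_pmf s (unif n))) {\<tau>. \<not> consistent f L \<tau>}"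
    using eps by (simp add: prob_pair_pmf)
  then show ?thesis by (simp add: prob_not)
qed

text \<open>If no coordinate is decoded, each check fails with probability above 1/48. The two cases
  exclude each other, so their bounds need not be added.\<close>

lemma pmf_extend_le:
  assumes "(47/48) ^ s' \<le> b"
    and "\<exists>i. decodes n (block_fun f e) i \<Longrightarrow> pmf (run (next (e # L)) f D) True \<le> b"
  shows "pmf (run (extend next L e) f D) True \<le> b"
proof -
  let ?all = "\<lambda>T. \<forall>t\<in>set T. literal_check n (block_fun f e) t"
  let ?g = "\<lambda>T. pmf (if ?all T then run (next (e # L)) f D else return_pmf False) True"
  have b: "0 \<le> b"
    using assms(1) order_trans[of 0 "(47/48) ^ s'" b] by simp
  have eq: "pmf (run (extend next L e) f D) True = (\<integral>T. ?g T \<partial>measure_pmf (replicate_pmf s' (unif3 n)))"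
    by (simp only: run_extend pmf_bind)
  show ?thesis
  proof (cases "\<exists>i. decodes n (block_fun f e) i")
    case True
    have "(\<integral>T. ?g T \<partial>measure_pmf (replicate_pmf s' (unif3 n))) \<le>
        measure_pmf.prob (replicate_pmf s' (unif3 n)) {T. False} + b"
      by (rule integral_pmf_le) (use assms(2)[OF True] b in \<open>auto simp: pmf_le_1\<close>)
    then show ?thesis unfolding eq by simp
  next
    case False
    then have "1/48 < measure_pmf.prob (unif3 n) {t. \<not> literal_check n (block_fun f e) t}"
      using literal_check_sound[of n "block_fun f e"] by force
    then have "measure_pmf.prob (unif3 n) {t. literal_check n (block_fun f e) t} \<le> 47/48"
      by (simp add: prob_not)
    then have "measure_pmf.prob (unif3 n) {t. literal_check n (block_fun f e) t} ^ s' \<le> (47/48) ^ s'"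
      by (intro power_mono) auto
    moreover have "(\<integral>T. ?g T \<partial>measure_pmf (replicate_pmf s' (unif3 n))) \<le>
        measure_pmf.prob (replicate_pmf s' (unif3 n)) {T. ?all T} + 0"
      by (rule integral_pmf_le) (auto simp: pmf_le_1)
    ultimately show ?thesis
      unfolding eq prob_replicate_all using assms(1) by simp
  qed
qed

text \<open>In each round the decoding test is passed with probability at most \<open>b\<close>, and
  these bounds add up over the rounds.\<close>

lemma pmf_tester_le:
  assumes small: "real k * (1/4) ^ s \<le> 1/2" and s: "1 \<le> s"
    and D: "set_pmf D \<subseteq> cube n" and far: "far_from_juntas n k eps D f"
    and b: "(47/48) ^ s' \<le> b" "(1 - eps/2) ^ t \<le> b"
    and "\<And>e. e \<in> set L \<Longrightarrow> \<exists>i. decodes n (block_fun f e) i" "length L + j \<le> k + 1"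
  shows "pmf (run (tester j L) f D) True \<le> real (j + 1) * b"
  using assms(7,8)
proof (induction j arbitrary: L)
  case 0
  have "0 \<le> b"
    using b(1) order_trans[of 0 "(47/48) ^ s'" b] by simp
  then show ?case by (simp add: tester_def)
next
  case (Suc j)
  let ?M = "pair_pmf D (replicate_pmf s (unif n))"
  \<comment> \<open>This bounds the remaining \<open>j\<close> rounds. It is at least
    \<open>b\<close> even for \<open>j = 0\<close>, which covers a literal test passed by
    mistake.\<close>
  let ?c = "real (j + 1) * b"
  have b0: "0 \<le> b"
    using b(1) order_trans[of 0 "(47/48) ^ s'" b] by simp
  have bc: "b \<le> ?c"
    using b0 by (simp add: algebra_simps)
  have "pmf (run (tester (Suc j) L) f D) True =
      (\<integral>\<omega>. pmf (run (process (tester j) L \<omega>) f D) True \<partial>measure_pmf (trials D))"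
    by (simp add: tester_def run_round pmf_bind)
  also have "\<dots> \<le> measure_pmf.prob (trials D) {\<omega>. \<forall>\<tau>\<in>set \<omega>. consistent f L \<tau>} + ?c"
  proof (rule integral_pmf_le)
    fix \<omega> assume \<omega>: "\<omega> \<in> set_pmf (trials D)" and nc: "\<not> (\<forall>\<tau>\<in>set \<omega>. consistent f L \<tau>)"
    show "pmf (run (process (tester j) L \<omega>) f D) True \<le> ?c"
    proof (cases "\<forall>\<tau>\<in>set \<omega>. f (fst \<tau>) = f (hybrid L (fst \<tau>) 0)")
      case True
      have "\<forall>\<tau>\<in>set \<omega>. snd \<tau> \<noteq> []"
        using \<omega> s by (force simp: set_replicate_pmf)
      then show ?thesis
        using nc b0 by (subst run_process_no_mismatch[OF True]) auto
    next
      case False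
      then obtain e where e: "run (process (tester j) L \<omega>) f D = run (extend (tester j) L e) f D"
        using run_process_mismatch[of \<omega> f L "tester j" D] by blast
      have "pmf (run (extend (tester j) L e) f D) True \<le> ?c"
      proof (rule pmf_extend_le)
        show "(47/48) ^ s' \<le> ?c" using b(1) bc by linarith
        assume "\<exists>i. decodes n (block_fun f e) i"
        then show "pmf (run (tester j (e # L)) f D) True \<le> ?c"
          using Suc.prems by (intro Suc.IH) auto
      qed
      with e show ?thesis by simp
    qed
  qed (use b0 in \<open>auto simp: pmf_le_1\<close>)
  also have "measure_pmf.prob (trials D) {\<omega>. \<forall>\<tau>\<in>set \<omega>. consistent f L \<tau>} \<le> b"
  proof -
    have "measure_pmf.prob ?M {\<tau>. consistent f L \<tau>} \<le> 1 - eps/2"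
      using Suc.prems by (intro prob_consistent_le[OF _ _ small D far]) auto
    then have "measure_pmf.prob ?M {\<tau>. consistent f L \<tau>} ^ t \<le> (1 - eps/2) ^ t"
      by (intro power_mono) auto
    then show ?thesis
      using b(2) by (simp add: prob_replicate_all)
  qed
  finally show ?case by (simp add: algebra_simps)
qed

subsection \<open>Completeness\<close>

text \<open>Exact counterpart of \<open>decodes\<close>, up to negation, with the coordinate lying
  in the block.\<close>

definition literal_at :: "(bool list \<Rightarrow> bool) \<Rightarrow> nat \<times> bool list \<Rightarrow> nat \<Rightarrow> bool" where
  "literal_at f e i \<longleftrightarrow> blk i = fst e \<and> (\<exists>c. \<forall>x\<in>cube n. block_fun f e x = (x ! i \<noteq> c))"

lemma decode_literal:
  assumes "literal_at f e i" "i < n" "u \<in> cube n" "z \<in> cube n"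
  shows "decode f u z e = u ! i"
proof -
  have "xorv u z ! i = (u ! i \<noteq> z ! i)"
    using assms by (simp add: cube_def)
  then show ?thesis
    using assms unfolding literal_at_def decode_def self_correct_def
    by (metis xorv_in_cube)
qed

lemma hybrid_all:
  assumes "u \<in> cube n" "\<And>j. j < n \<Longrightarrow> blk j < 2 ^ m"
  shows "hybrid L u (2 ^ m) = u"
  using assms by (intro cube_eqI[of _ n]) (auto simp: hybrid_def)

context
  fixes f :: "bool list \<Rightarrow> bool" and J :: "nat set"
  assumes J: "J \<subseteq> {..<n}" and inj: "inj_on blk J"
    and dep: "\<And>x y. x \<in> cube n \<Longrightarrow> y \<in> cube n \<Longrightarrow> (\<And>i. i \<in> J \<Longrightarrow> x ! i = y ! i) \<Longrightarrow> f x = f y"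
begin

text \<open>Every found block contains exactly one coordinate of \<open>J\<close>, so the guess and
  the zeroed sample agree on \<open>J\<close>, and \<open>f\<close> sees nothing else.\<close>

lemma consistent_literals:
  assumes lit: "\<And>e. e \<in> set L \<Longrightarrow> \<exists>i\<in>J. literal_at f e i"
    and u: "u \<in> cube n" and zs: "set zs \<subseteq> cube n" "zs \<noteq> []"
    and eq: "f u = f (hybrid L u 0)"
  shows "consistent f L (u, zs)"
proof -
  obtain v where v: "\<And>e. e \<in> set L \<Longrightarrow> v e \<in> J \<and> literal_at f e (v e)"
    using lit by metis
  have d: "decode f u z e = u ! v e" if "e \<in> set L" "z \<in> set zs" for e z
    using v[OF that(1)] that(2) J u zs by (intro decode_literal) auto
  have hd: "hd zs \<in> set zs" using zs by simp
  have "f (guess f L (u, zs)) = f (hybrid L u 0)"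
  proof (rule dep)
    fix i assume i: "i \<in> J"
    have vi: "u ! v e = u ! i" if "e \<in> set L" "fst e = blk i" for e
      using v[OF that(1)] that(2) i inj by (metis inj_onD literal_at_def)
    have "(\<exists>e\<in>set L. fst e = blk i \<and> decode f u (hd zs) e) = (\<exists>e\<in>set L. fst e = blk i \<and> u ! i)"
      using d[OF _ hd] vi by (intro bex_cong refl conj_cong) simp_all
    also have "\<dots> = (blk i \<in> fst ` set L \<and> u ! i)"
      by force
    finally show "guess f L (u, zs) ! i = hybrid L u 0 ! i"
      using i J by (simp add: guess_def point_def hybrid_def subset_iff)
  qed (auto simp: guess_def)
  with eq d hd show ?thesis
    by (auto simp: consistent_def unanimous_def)
qed

text \<open>On \<open>J\<close> the hybrids differ only at the one coordinate \<open>v\<close> of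
  block \<open>i\<close>, which is set in the later hybrid. Varying the block thus switches between
  the two different values of \<open>f\<close> according to \<open>x ! v\<close>.\<close>

lemma literal_of_hybrid_mismatch:
  assumes ne: "f (hybrid L u i) \<noteq> f (hybrid L u (Suc i))"
  shows "i \<notin> fst ` set L \<and> (\<exists>v\<in>J. literal_at f (i, hybrid L u (Suc i)) v)"
proof -
  let ?w = "hybrid L u (Suc i)"
  obtain v where v: "v \<in> J" "hybrid L u i ! v \<noteq> ?w ! v"
    using ne dep[of "hybrid L u i" ?w] by auto
  then have vn: "v < n" using J by auto
  have bv: "blk v = i" "i \<notin> fst ` set L" "u ! v"
    using v(2) vn by (auto simp: hybrid_def less_Suc_eq)
  have "block_fun f (i, ?w) x = (x ! v \<noteq> (\<not> f ?w))" if x: "x \<in> cube n" for x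
  proof (cases "x ! v")
    case True
    have "f (mix (i, ?w) x) = f ?w"
    proof (rule dep)
      fix j assume j: "j \<in> J"
      then have "j < n" using J by auto
      moreover have "j = v" if "blk j = i"
        using that j v(1) bv(1) inj by (auto dest: inj_onD)
      ultimately show "mix (i, ?w) x ! j = ?w ! j"
        using True bv vn by (auto simp: mix_def hybrid_def)
    qed auto
    with True show ?thesis by (simp add: block_fun_def)
  next
    case False
    have "f (mix (i, ?w) x) = f (hybrid L u i)"
    proof (rule dep)
      fix j assume j: "j \<in> J"
      then have "j < n" using J by auto
      moreover have "j = v" if "blk j = i"
        using that j v(1) bv(1) inj by (auto dest: inj_onD)
      ultimately show "mix (i, ?w) x ! j = hybrid L u i ! j"
        using False bv vn by (auto simp: mix_def hybrid_def less_Suc_eq)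
    qed auto
    with False ne show ?thesis by (simp add: block_fun_def)
  qed
  then have "literal_at f (i, ?w) v"
    using bv by (auto simp: literal_at_def)
  with v bv show ?thesis by blast
qed

lemma run_tester_junta:
  assumes D: "set_pmf D \<subseteq> cube n" and s: "1 \<le> s" and blk: "\<And>j. j < n \<Longrightarrow> blk j < 2 ^ m"
    and k: "card J \<le> k"
    and "\<And>e. e \<in> set L \<Longrightarrow> \<exists>i\<in>J. literal_at f e i" "distinct (map fst L)" "length L + j = k + 1"
  shows "run (tester j L) f D = return_pmf True"
  using assms(5-7)
proof (induction j arbitrary: L)
  \<comment> \<open>With no round left there would be \<open>k + 1\<close> distinct blocks, each
    containing a coordinate of \<open>J\<close>, against \<open>card J \<le> k\<close>.\<close>
  case 0
  have "finite J" using J finite_subset by blast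
  have "length L = card (fst ` set L)"
    using distinct_card[OF 0(2)] by simp
  also have "\<dots> \<le> card (blk ` J)"
    using 0(1) \<open>finite J\<close> by (intro card_mono) (auto simp: literal_at_def, force)
  also have "\<dots> \<le> k"
    using k card_image_le[OF \<open>finite J\<close>, of blk] by simp
  finally show ?case using 0(3) by simp
next
  case (Suc j)
  have "run (process (tester j) L \<omega>) f D = return_pmf True" if \<omega>: "\<omega> \<in> set_pmf (trials D)" for \<omega>
  proof -
    have \<tau>: "fst \<tau> \<in> cube n" "set (snd \<tau>) \<subseteq> cube n" "snd \<tau> \<noteq> []" if "\<tau> \<in> set \<omega>" for \<tau>
    proof -
      have "\<tau> \<in> set_pmf (pair_pmf D (replicate_pmf s (unif n)))"
        using \<omega> that by (auto simp: set_replicate_pmf)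
      then have "fst \<tau> \<in> set_pmf D" "snd \<tau> \<in> lists (set_pmf (unif n))" "length (snd \<tau>) = s"
        by (auto simp: set_replicate_pmf[of s])
      with D s show "fst \<tau> \<in> cube n" "set (snd \<tau>) \<subseteq> cube n" "snd \<tau> \<noteq> []"
        by auto
    qed
    show ?thesis
    proof (cases "\<forall>\<tau>\<in>set \<omega>. f (fst \<tau>) = f (hybrid L (fst \<tau>) 0)")
      case True
      have "consistent f L \<tau>" if "\<tau> \<in> set \<omega>" for \<tau>
        using consistent_literals[where L = L and u = "fst \<tau>" and zs = "snd \<tau>"] Suc.prems(1) \<tau>[OF that] True that
        by simp
      then show ?thesis
        using \<tau>(3) by (subst run_process_no_mismatch[OF True]) auto
    next
      case False
      then obtain \<tau> i where mem: "\<tau> \<in> set \<omega>"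
        and r: "run (process (tester j) L \<omega>) f D =
            run (extend (tester j) L (i, hybrid L (fst \<tau>) (Suc i))) f D"
        and ne: "f (hybrid L (fst \<tau>) (2 ^ m)) = f (fst \<tau>) \<longrightarrow>
            f (hybrid L (fst \<tau>) i) \<noteq> f (hybrid L (fst \<tau>) (Suc i))"
        using run_process_mismatch[of \<omega> f L "tester j" D] by blast
      let ?e = "(i, hybrid L (fst \<tau>) (Suc i))"
      have "f (hybrid L (fst \<tau>) i) \<noteq> f (hybrid L (fst \<tau>) (Suc i))"
        using ne hybrid_all[OF \<tau>(1)[OF mem] blk] by simp
      then obtain v where new: "i \<notin> fst ` set L" and v: "v \<in> J" "literal_at f ?e v"
        using literal_of_hybrid_mismatch by blast
      have next_run: "run (tester j (?e # L)) f D = return_pmf True"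
        using Suc.prems new v by (intro Suc.IH) auto
      obtain c where "\<forall>x\<in>cube n. block_fun f ?e x = (x ! v \<noteq> c)"
        using v(2) by (auto simp: literal_at_def)
      then have chk: "literal_check n (block_fun f ?e) t" if "t \<in> set_pmf (unif3 n)" for t
        using v(1) J that by (intro literal_check_complete[where i = v and c = c]) auto
      have "run (extend (tester j) L ?e) f D =
          bind_pmf (replicate_pmf s' (unif3 n)) (\<lambda>_. return_pmf True)"
        unfolding run_extend next_run
        by (intro bind_pmf_cong refl if_P ballI chk) (auto simp: set_replicate_pmf[of s'])
      then show ?thesis by (simp add: r)
    qed
  qed
  then have "run (tester (Suc j) L) f D = bind_pmf (trials D) (\<lambda>_. return_pmf True)"
    unfolding tester_def funpow.simps comp_apply run_round by (intro bind_pmf_cong refl)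
  then show ?case by simp
qed

end

end

section \<open>Random partition and choice of parameters\<close>

primrec bits_to_nat :: "bool list \<Rightarrow> nat" where
  "bits_to_nat [] = 0"
| "bits_to_nat (b # bs) = of_bool b + 2 * bits_to_nat bs"

lemma bits_to_nat_less: "bits_to_nat bs < 2 ^ length bs"
  by (induction bs) auto

lemma bits_to_nat_inj: "bits_to_nat bs = bits_to_nat cs \<Longrightarrow> length bs = length cs \<Longrightarrow> bs = cs"
proof (induction bs arbitrary: cs)
  case (Cons b bs)
  then obtain c cs' where c: "cs = c # cs'" by (cases cs) auto
  then have eq: "of_bool b + 2 * bits_to_nat bs = of_bool c + 2 * bits_to_nat cs'"
    using Cons.prems by simp
  then have "b = c" by (cases b; cases c) (simp_all, presburger+)
  with eq show ?case using Cons c by simp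
qed simp

text \<open>The \<open>i\<close>-th bits of \<open>m\<close> random vectors form a uniform block
  number below \<open>2 ^ m\<close> for coordinate \<open>i\<close>, independently for different
  coordinates.\<close>

definition block_of :: "bool list list \<Rightarrow> nat \<Rightarrow> nat" where
  "block_of bs i = bits_to_nat (map (\<lambda>b. b ! i) bs)"

lemma block_of_eq_iff: "block_of bs i = block_of bs j \<longleftrightarrow> (\<forall>b\<in>set bs. b ! i = b ! j)"
  using bits_to_nat_inj[of "map (\<lambda>b. b ! i) bs" "map (\<lambda>b. b ! j) bs"]
  by (auto simp: block_of_def cong: map_cong)

text \<open>Birthday bound: a pair collides with probability \<open>(1/2) ^ m\<close>, and there are
  at most \<open>k ^ 2\<close> ordered pairs.\<close>

lemma prob_not_inj_block_of:
  assumes J: "J \<subseteq> {..<n}" "card J \<le> k"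
  shows "measure_pmf.prob (replicate_pmf m (unif n)) {bs. \<not> inj_on (block_of bs) J} \<le> real k ^ 2 * (1/2) ^ m"
proof -
  have "finite J" using J(1) finite_subset by blast
  define P where "P = {p \<in> J \<times> J. fst p \<noteq> snd p}"
  have "finite P" using \<open>finite J\<close> by (simp add: P_def)
  then obtain ps where ps: "set ps = P" "distinct ps"
    using finite_distinct_list by blast
  have "card P \<le> card (J \<times> J)"
    using \<open>finite J\<close> by (intro card_mono) (auto simp: P_def)
  also have "\<dots> \<le> k * k"
    using J(2) by (simp add: card_cartesian_product mult_le_mono)
  finally have len: "length ps \<le> k * k"
    using ps distinct_card[of ps] by simp
  have "measure_pmf.prob (replicate_pmf m (unif n)) {bs. \<not> inj_on (block_of bs) J} \<le>
      measure_pmf.prob (replicate_pmf m (unif n)) {bs. \<exists>p\<in>set ps. \<forall>b\<in>set bs. b ! fst p = b ! snd p}"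
    by (rule prob_mono_on) (auto simp: ps P_def inj_on_def block_of_eq_iff)
  also have "\<dots> \<le> real (length ps) * (1/2) ^ m"
  proof (rule prob_Bex_list_le)
    fix p assume "p \<in> set ps"
    then have "fst p < n" "snd p < n" "fst p \<noteq> snd p"
      using J by (auto simp: ps P_def)
    then show "measure_pmf.prob (replicate_pmf m (unif n)) {bs. \<forall>b\<in>set bs. b ! fst p = b ! snd p} \<le> (1/2) ^ m"
      by (simp add: prob_replicate_all prob_unif_nth_eq)
  qed
  also have "\<dots> \<le> real (k * k) * (1/2) ^ m"
    by (rule mult_right_mono[OF of_nat_mono[OF len]]) simp
  finally show ?thesis by (simp add: power2_eq_square)
qed

definition junta_tester :: "nat \<Rightarrow> nat \<Rightarrow> nat \<Rightarrow> nat \<Rightarrow> nat \<Rightarrow> nat \<Rightarrow> alg" where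
  "junta_tester n k m t s s' = repeat_draw m (coins n)
     (\<lambda>bs. block_tester.tester n (block_of bs) m t s s' (k + 1) [])"

lemma run_junta_tester:
  "run (junta_tester n k m t s s') f D = bind_pmf (replicate_pmf m (unif n))
     (\<lambda>bs. run (block_tester.tester n (block_of bs) m t s s' (k + 1) []) f D)"
proof -
  have "draws f D (repeat_draw m (coins n)) (replicate_pmf m (unif n))"
    by (intro draws_intros)
  then show ?thesis by (simp add: draws_def junta_tester_def)
qed

lemma queries_le_junta_tester:
  "queries_le (junta_tester n k m t s s') ((k + 1) * (2 * t + m + 7 * s') + (2 * k * s * t + 2 * t))"
  unfolding junta_tester_def
  by (rule query_freeD[OF query_free_repeat[OF query_free_repeat[OF query_free_Coin]]])
    (rule block_tester.queries_le_tester, simp)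

text \<open>Completeness loses only the event that the hash is not injective on \<open>J\<close>;
  soundness holds for every hash. The factor \<open>k + 2\<close> stems from \<open>k + 1\<close>
  rounds: up to \<open>k\<close> that find a block and one that decodes.\<close>

lemma df_junta_tester_junta_tester:
  assumes s: "1 \<le> s" "real k * (1/4) ^ s \<le> 1/2" and m: "real k ^ 2 * (1/2) ^ m \<le> 1/3"
    and b: "(47/48) ^ s' \<le> b" "(1 - eps/2) ^ t \<le> b" "(real k + 2) * b \<le> 1/3"
  shows "df_junta_tester n k eps (junta_tester n k m t s s')"
  unfolding df_junta_tester_def
proof (intro allI impI conjI)
  fix f D assume D: "set_pmf D \<subseteq> cube n"
  let ?M = "replicate_pmf m (unif n)"
  let ?g = "\<lambda>bs. pmf (run (block_tester.tester n (block_of bs) m t s s' (k + 1) []) f D) True"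
  have run: "pmf (run (junta_tester n k m t s s') f D) True = (\<integral>bs. ?g bs \<partial>measure_pmf ?M)"
    by (simp add: run_junta_tester pmf_bind)
  show "2/3 \<le> pmf (run (junta_tester n k m t s s') f D) True" if junta: "is_junta n k f"
  proof -
    obtain J where J: "J \<subseteq> {..<n}" "card J \<le> k"
      and dep: "\<forall>x\<in>cube n. \<forall>y\<in>cube n. (\<forall>i\<in>J. x ! i = y ! i) \<longrightarrow> f x = f y"
      using junta by (auto simp: is_junta_def)
    have "1 * measure_pmf.prob ?M {bs. inj_on (block_of bs) J} \<le> (\<integral>bs. ?g bs \<partial>measure_pmf ?M)"
    proof (rule integral_pmf_ge)
      fix bs assume bs: "bs \<in> set_pmf ?M" and inj: "inj_on (block_of bs) J"
      have "block_of bs j < 2 ^ m" for j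
        using bits_to_nat_less[of "map (\<lambda>b. b ! j) bs"] bs
        by (auto simp: block_of_def set_replicate_pmf[of m])
      then have "run (block_tester.tester n (block_of bs) m t s s' (k + 1) []) f D = return_pmf True"
      proof (intro block_tester.run_tester_junta[OF J(1) inj _ D s(1) _ J(2)])
        show "f x = f y" if "x \<in> cube n" "y \<in> cube n" "\<And>i. i \<in> J \<Longrightarrow> x ! i = y ! i" for x y
          using dep that by blast
      qed simp_all
      then show "1 \<le> ?g bs" by simp
    qed (auto simp: pmf_le_1)
    moreover have "measure_pmf.prob ?M {bs. \<not> inj_on (block_of bs) J} \<le> 1/3"
      using prob_not_inj_block_of[OF J, of m] m by simp
    ultimately show ?thesis
      unfolding run by (simp add: prob_not)
  qed
  show "2/3 \<le> pmf (run (junta_tester n k m t s s') f D) False" if far: "far_from_juntas n k eps D f"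
  proof -
    have "(\<integral>bs. ?g bs \<partial>measure_pmf ?M) \<le> measure_pmf.prob ?M {bs. False} + 1/3"
    proof (rule integral_pmf_le)
      fix bs
      have "?g bs \<le> real (k + 1 + 1) * b"
        by (rule block_tester.pmf_tester_le[OF s(2,1) D far b(1,2)]) auto
      then show "?g bs \<le> 1/3" using b(3) by (simp add: algebra_simps)
    qed (auto simp: pmf_le_1)
    then show ?thesis
      unfolding run[symmetric] by (simp add: pmf_False_conv_True)
  qed
qed

text \<open>The power \<open>N\<close> brings \<open>1 - x\<close> below \<open>exp (- 1)\<close>,
  hence below 1/2, and the exponent \<open>2 * l\<close> turns this into a power of 1/4.\<close>

lemma one_minus_power_le:
  fixes x :: real
  assumes "0 \<le> x" "x \<le> 1" "1 \<le> x * real N"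
  shows "(1 - x) ^ (N * (2 * l)) \<le> (1/4) ^ l"
proof -
  have "(1 - x) ^ N \<le> exp (- x) ^ N"
    using assms exp_ge_add_one_self[of "- x"] by (intro power_mono) auto
  also have "\<dots> = exp (- (x * real N))"
    by (simp add: exp_of_nat_mult[symmetric] mult.commute)
  also have "\<dots> \<le> exp (- 1)"
    using assms by simp
  also have "\<dots> \<le> 1/2"
    using exp_ge_add_one_self[of "1::real"] by (simp add: exp_minus field_simps)
  finally have "((1 - x) ^ N) ^ (2 * l) \<le> (1/2) ^ (2 * l)"
    using assms by (intro power_mono) auto
  then show ?thesis by (simp add: power_mult power2_eq_square)
qed

theorem theorem1:
  shows "\<exists>(C::real) (c::nat). C > 0 \<and>
    (\<forall>(n::nat) (k::nat) (eps::real). 1 \<le> k \<longrightarrow> 0 < eps \<longrightarrow>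
       (\<exists>A. df_junta_tester n k eps A \<and>
            queries_le A (nat \<lfloor>C * (real k / eps) * (ln (real k / eps + 2)) ^ c\<rfloor>)))"
\<comment> \<open>24000 is 1500 times 16, the latter from replacing \<open>l\<close> by
  \<open>4 * ln x\<close>. One logarithm is due to \<open>t\<close>, the other to the
  \<open>l\<close> decoding points per sample.\<close>
proof (intro exI[of _ "24000::real"] exI[of _ "2::nat"] conjI allI impI)
  fix n k :: nat and eps :: real
  assume k: "1 \<le> k" and eps: "0 < eps"
  let ?bound = "24000 * (real k / eps) * (ln (real k / eps + 2)) ^ 2"
  show "\<exists>A. df_junta_tester n k eps A \<and> queries_le A (nat \<lfloor>?bound\<rfloor>)"
  proof (cases "eps \<le> 1")
    case False
    \<comment> \<open>A distance above 1 is impossible, so accepting without queries is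
      correct.\<close>
    have "\<not> far_from_juntas n k eps D f" for D f
    proof
      assume far: "far_from_juntas n k eps D f"
      have "is_junta n k (\<lambda>_. True)"
        by (auto simp: is_junta_def intro!: exI[of _ "{}"])
      then have "eps \<le> measure_pmf.prob D {x. f x \<noteq> True}"
        using far unfolding far_from_juntas_def by blast
      also have "\<dots> \<le> 1" by simp
      finally show False using False by simp
    qed
    then have "df_junta_tester n k eps Accept"
      by (simp add: df_junta_tester_def)
    then show ?thesis by (intro exI[of _ Accept]) simp
  next
    case True
    define x where "x = real k / eps + 2"
    define l where "l = nat \<lceil>log 2 x\<rceil>"
    define N where "N = nat \<lceil>2 / eps\<rceil>"
    have ke: "real k \<le> real k / eps" "1 \<le> 1 / eps"
      using True eps by (simp_all add: le_divide_eq mult_left_le)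
    then have x3: "3 \<le> x" using k by (simp add: x_def)
    have log1: "1 \<le> log 2 x"
      using x3 by (simp add: le_log_iff)
    have l_ge: "log 2 x \<le> real l" and l_le: "real l \<le> log 2 x + 1"
      using log1 by (simp_all add: l_def)
    have l1: "1 \<le> l" using l_ge log1 by linarith
    have "x = 2 powr (log 2 x)" using x3 by simp
    also have "\<dots> \<le> 2 powr (real l)" using l_ge by (intro powr_mono) auto
    finally have "x \<le> 2 ^ l" by (simp add: powr_realpow)
    then have kl: "real k + 2 \<le> 2 ^ l" using ke(1) by (simp add: x_def)
    have quarter: "(1/4 :: real) ^ l \<le> 1 / (real k + 2) ^ 2"
    proof -
      have "(real k + 2) ^ 2 \<le> (2 ^ l) ^ 2" using kl by (intro power_mono) auto
      also have "((2::real) ^ l) ^ 2 = 4 ^ l" by (simp add: power_mult[symmetric] mult.commute[of l] power_mult)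
      finally show ?thesis by (simp add: power_one_over frac_le)
    qed
    have N: "2 / eps \<le> real N" "real N \<le> 3 / eps"
    proof -
      show "2 / eps \<le> real N" using eps by (simp add: N_def)
      have "real N \<le> 2 / eps + 1" using eps by (simp add: N_def)
      then show "real N \<le> 3 / eps" using ke(2) by (simp add: field_simps)
    qed
    \<comment> \<open>\<open>t\<close> and \<open>s'\<close> fit \<open>one_minus_power_le\<close>
      with \<open>x = eps/2\<close> and \<open>x = 1/48\<close>; \<open>m\<close> makes the number
      of blocks \<open>4 * 4 ^ l\<close>, which is at least \<open>4 * (k + 2) ^ 2\<close>.\<close>
    define t where "t = N * (2 * l)"
    define s' where "s' = 48 * (2 * l)"
    define m where "m = 2 * l + 2"
    have "df_junta_tester n k eps (junta_tester n k m t l s')"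
    \<comment> \<open>With this \<open>b\<close> the total error is \<open>1 / (k + 2)\<close>, at
      most 1/3 because \<open>k\<close> is positive.\<close>
    proof (rule df_junta_tester_junta_tester[where b = "1 / (real k + 2) ^ 2"])
      have sq: "2 * real k \<le> (real k + 2) ^ 2" "3 * real k ^ 2 \<le> 4 * (real k + 2) ^ 2"
          "0 < (real k + 2) ^ 2"
        by (simp add: power2_eq_square algebra_simps, simp add: power2_eq_square algebra_simps, simp add: add_pos_nonneg)
      show "1 \<le> l" by (rule l1)
      have "real k * (1/4) ^ l \<le> real k * (1 / (real k + 2) ^ 2)"
        using quarter by (intro mult_left_mono) auto
      also have "\<dots> \<le> 1/2"
        using sq by (simp add: divide_le_eq)
      finally show "real k * (1/4) ^ l \<le> 1/2" .
      have "real k ^ 2 * (1/2) ^ m = real k ^ 2 * (1/4) ^ l / 4"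
        by (simp add: m_def power_add power_mult power2_eq_square)
      also have "\<dots> \<le> real k ^ 2 * (1 / (real k + 2) ^ 2) / 4"
        using quarter by (intro divide_right_mono mult_left_mono) auto
      also have "\<dots> \<le> 1/3"
        using sq by (simp add: divide_le_eq)
      finally show "real k ^ 2 * (1/2) ^ m \<le> 1/3" .
      have "(1 - 1/48 :: real) ^ s' \<le> (1/4) ^ l"
        unfolding s'_def by (rule one_minus_power_le) auto
      with quarter show "(47/48) ^ s' \<le> 1 / (real k + 2) ^ 2" by simp
      have "(1 - eps/2) ^ t \<le> (1/4) ^ l"
        unfolding t_def using eps True N(1) by (intro one_minus_power_le) (auto simp: field_simps)
      with quarter show "(1 - eps/2) ^ t \<le> 1 / (real k + 2) ^ 2" by simp
      have "(real k + 2) * (1 / (real k + 2) ^ 2) = 1 / (real k + 2)"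
        by (simp add: power2_eq_square)
      also have "\<dots> \<le> 1/3"
        using k by (intro divide_left_mono) auto
      finally show "(real k + 2) * (1 / (real k + 2) ^ 2) \<le> 1/3" .
    qed
    moreover have "queries_le (junta_tester n k m t l s') (nat \<lfloor>?bound\<rfloor>)"
    proof (rule queries_le_mono[OF queries_le_junta_tester])
      define K where "K = real k / eps"
      define q where "q = real l"
      have q: "1 \<le> q" using l1 by (simp add: q_def)
      have K: "real k \<le> K" "1 / eps \<le> K" "1 \<le> K" "0 \<le> K"
        using ke k eps by (auto simp: K_def field_simps)
      have t: "real t \<le> 6 * q / eps"
        using mult_right_mono[OF N(2), of "2 * q"] q by (simp add: t_def q_def)
      have kt: "real k * real t \<le> 6 * q * K"
        using mult_left_mono[OF t, of "real k"] by (simp add: K_def field_simps)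
      have tK: "real t \<le> 6 * q * K"
        using t mult_left_mono[OF K(2), of "6 * q"] q by simp
      have qq: "q \<le> q ^ 2" using q by (simp add: power2_eq_square)
      have Kq: "K * q \<le> K * q ^ 2" using qq K by (intro mult_left_mono) auto
      have kq: "real k * q \<le> K * q" "q \<le> K * q" "real k \<le> K * q" "1 \<le> K * q"
        using mult_right_mono[OF K(1), of q] mult_right_mono[OF K(3), of q]
          mult_left_mono[OF q, of K] K q by linarith+
      have ktq: "real k * real t * q \<le> 6 * q ^ 2 * K"
        using mult_right_mono[OF kt, of q] q by (simp add: power2_eq_square mult_ac)
      \<comment> \<open>674 is 2 from \<open>m\<close> plus 7 times 96 from \<open>s'\<close>. In
        units of \<open>K * q ^ 2\<close> the terms total at most 1400.\<close>
      have "real ((k + 1) * (2 * t + m + 7 * s') + (2 * k * l * t + 2 * t)) =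
         2 * (real k * real t) + 674 * (real k * q) + 2 * real k + 4 * real t + 674 * q + 2
           + 2 * (real k * real t * q)"
        by (simp add: m_def s'_def q_def algebra_simps)
      also have "\<dots> \<le> 1500 * (K * q ^ 2)"
        using kt tK kq ktq Kq by (simp add: algebra_simps)
      also have "\<dots> \<le> 1500 * (K * (16 * (ln x) ^ 2))"
      proof -
        have "1 / 2 \<le> ln (2::real)" using ln2_ge_two_thirds by simp
        then have "q * (1/2) \<le> q * ln 2" using q by (intro mult_left_mono) auto
        also have "q \<le> 2 * log 2 x" using l_le log1 by (simp add: q_def)
        then have "q * ln 2 \<le> 2 * log 2 x * ln 2" by (intro mult_right_mono) auto
        also have "\<dots> = 2 * ln x" by (simp add: log_def)
        finally have "q \<le> 4 * ln x" by simp
        then have "q ^ 2 \<le> (4 * ln x) ^ 2" using q by (intro power_mono) auto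
        then show ?thesis using K by (intro mult_left_mono) (auto simp: power_mult_distrib)
      qed
      also have "\<dots> = ?bound"
        by (simp add: x_def K_def)
      finally show "(k + 1) * (2 * t + m + 7 * s') + (2 * k * l * t + 2 * t) \<le> nat \<lfloor>?bound\<rfloor>"
        by (simp add: le_nat_floor)
    qed
    ultimately show ?thesis by blast
  qed
qed simp

end
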